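(* Let $\{\varepsilon_i : i \in \mathbb{Z}\}$ be independent and identically distributed real random variables with $\mathbb{E}\varepsilon_i = 0$ and finite variance, having a common bounded probability density $f_\varepsilon$. Let $\{a_i\}_{i\ge 0}$ be real coefficients with $\sum_{i=0}^\infty |a_i| < \infty$ and $\sum_{i=0}^\infty a_i \neq 0$, and let $X_n = \sum_{i=0}^\infty a_i \varepsilon_{n-i}$, $n \in \mathbb{N}$, with common marginal density $f$. Assume $S(f) = -\int_{\mathbb{R}} f(x)\log f(x)\,dx$ is finite. Let $K$ be a kernel with $\int K = 1$, $\{h_n\}$ positive bandwidths, and $f_n(x) = \frac{1}{nh_n}\sum_{i=1}^n K\big(\frac{x-X_i}{h_n}\big)$. Assume: $h_n \asymp (n^{-1}\log n)^{1/5}$; $K$ is bounded, has bounded support and is Hölder continuous of some order $\iota\in(0,1]$; $\int uK(u)\,du = 0$; $f_\varepsilon, f_\varepsilon', f_\varepsilon''$ are bounded and belong to $\mathcal{L}^2(\mathbb{R})$; $f''$ is bounded. Let $\{\gamma_n\}$ be positive reals with $\gamma_n\to 0$ and $h_n = o(\gamma_n)$, let $A_n = \{x : 0<\gamma_n \le f_n(x)\}$ and $S_n(f) = -\int_{A_n} f_n(x)\log f_n(x)\,dx$. Then $$\limsup_{n\to\infty} \Big(\frac{n\gamma_n^5}{\log n}\Big)^{2/5}\,\Big\| S_n(f) - \int_{A_n} \big(-\log f(x)\big) f(x)\,dx\Big\|_2 < \infty,$$ where $\|Y\|_2 = (\mathbb{E} Y^2)^{1/2}$.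
   Context: $a_n \asymp b_n$ means $0<\liminf a_n/b_n \le \limsup a_n/b_n<\infty$. *)

theory Defs
  imports "HOL-Probability.Probability" "HOL-Library.Landau_Symbols"
begin

definition L2norm :: "'a measure \<Rightarrow> ('a \<Rightarrow> real) \<Rightarrow> ennreal" where
  "L2norm M Y = (let I = (\<integral>\<^sup>+ \<omega>. ennreal ((Y \<omega>)\<^sup>2) \<partial>M) in
      if I = \<infinity> then \<infinity> else ennreal (sqrt (enn2real I)))"

definition linproc :: "(nat \<Rightarrow> real) \<Rightarrow> (int \<Rightarrow> 'a \<Rightarrow> real) \<Rightarrow> nat \<Rightarrow> 'a \<Rightarrow> real" where
  "linproc a eps n \<omega> = (\<Sum>i. a i * eps (int n - int i) \<omega>)"

definition kde :: "(real \<Rightarrow> real) \<Rightarrow> (nat \<Rightarrow> real) \<Rightarrow> (nat \<Rightarrow> 'a \<Rightarrow> real) \<Rightarrow> nat \<Rightarrow> 'a \<Rightarrow> real \<Rightarrow> real" where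
  "kde K h X n \<omega> x = (1 / (real n * h n)) * (\<Sum>i=1..n. K ((x - X i \<omega>) / h n))"

end

theory Submission
  imports Defs
begin

text \<open>
  Write \<open>ISE = \<integral> (f\<^sub>n - f)\<^sup>2\<close>. A pointwise expansion of \<open>y ln y\<close> on \<open>{f\<^sub>n \<ge> \<gamma>}\<close> bounds the square of the
  error in question by \<open>C ISE / \<gamma>\<^sup>2\<close>, so that it suffices to show \<open>E ISE = O(h\<^sup>4)\<close>.

  Let \<open>a\<^sub>k\<close> be the first nonzero coefficient and \<open>g\<close> the density of \<open>a\<^sub>k \<epsilon>\<close>. The bias part is \<open>O(h\<^sup>4)\<close>
  because \<open>f\<close> is an average of translates of \<open>g\<close>, and \<open>g''\<close> is square integrable.

  For the variance part let \<open>W\<close> be the autocorrelation of the rescaled kernel. The integrated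
  covariance of the kernel terms at times \<open>i < j\<close> is \<open>E W(X\<^sub>j - X\<^sub>i) - E W(X\<^sub>j - X\<^sub>i')\<close>, where \<open>X\<^sub>i'\<close> is
  an independent copy. The innovation \<open>\<epsilon>\<^sub>j\<^sub>-\<^sub>k\<close> does not enter \<open>X\<^sub>i\<close>; integrating it out turns \<open>W\<close>
  into a function whose second differences are bounded uniformly in \<open>h\<close>. Replacing the remaining
  innovations of \<open>X\<^sub>i\<close> one at a time then costs \<open>O(\<Sum>\<^sub>l |a\<^sub>l a\<^sub>l\<^sub>+\<^sub>j\<^sub>-\<^sub>i|)\<close>, which is summable over the lag.
\<close>

section \<open>Truncated entropy\<close>

text \<open>The target O(h^4) is dictated by the bandwidth: n h^5 stays above a positive constant,
  so the variance order 1/(n h) is O(h^4), the order of the squared bias. The L2 error is then O(h^2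
  / \<gamma>) and the normalising factor is O(\<gamma>^2 / h^2), so their product is O(\<gamma>).
  The obstacle is the off-diagonal part of the variance: about n^2 covariances, which must be
  bounded independently of h and summed over all lags, although the coefficients are only absolutely
  summable and the innovations only have second moments. The autocorrelation \<open>W\<close> has
  supremum of order 1/h, but its L1 norm is bounded independently of h. Off the diagonal every
  estimate is therefore moved onto the L1 norm, and all smoothness is taken from \<open>g\<close>.
  Choosing the first nonzero coefficient makes the innovation at time j - k newer than all those
  that enter \<open>X\<^sub>i\<close> with nonzero weight. The bias is measured in L2 over the whole
  line, because a uniform pointwise bound O(h^2) is not square integrable there.\<close>

lemma integrable_mult_of_squares:
  fixes u v :: "'b \<Rightarrow> real"
  assumes [measurable]: "u \<in> borel_measurable M" "v \<in> borel_measurable M"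
    and "integrable M (\<lambda>x. (u x)\<^sup>2)" "integrable M (\<lambda>x. (v x)\<^sup>2)"
  shows "integrable M (\<lambda>x. u x * v x)"
proof (rule Bochner_Integration.integrable_bound)
  show "integrable M (\<lambda>x. (u x)\<^sup>2 + (v x)\<^sup>2)"
    using assms by auto
  have "\<bar>u x * v x\<bar> \<le> (u x)\<^sup>2 + (v x)\<^sup>2" for x
  proof -
    have "2 * (\<bar>u x\<bar> * \<bar>v x\<bar>) \<le> (u x)\<^sup>2 + (v x)\<^sup>2"
      using sum_squares_bound[of "\<bar>u x\<bar>" "\<bar>v x\<bar>"] by (simp add: mult.assoc)
    moreover have "0 \<le> \<bar>u x\<bar> * \<bar>v x\<bar>" by simp
    ultimately show ?thesis unfolding abs_mult by linarith
  qed
  then show "AE x in M. norm (u x * v x) \<le> norm ((u x)\<^sup>2 + (v x)\<^sup>2)"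
    by auto
qed auto

text \<open>The integral of (s u - t v)^2 is a nonnegative quadratic form in (s, t). The choice s =
  c, t = b yields c (a c - b^2) \<ge> 0 without dividing; for c = 0 the form is affine in t and
  forces b = 0.\<close>

lemma integral_Cauchy_Schwarz:
  fixes u v :: "'b \<Rightarrow> real"
  assumes m[measurable]: "u \<in> borel_measurable M" "v \<in> borel_measurable M"
    and u: "integrable M (\<lambda>x. (u x)\<^sup>2)" and v: "integrable M (\<lambda>x. (v x)\<^sup>2)"
  shows "(\<integral>x. u x * v x \<partial>M)\<^sup>2 \<le> (\<integral>x. (u x)\<^sup>2 \<partial>M) * (\<integral>x. (v x)\<^sup>2 \<partial>M)"
proof -
  note uv = integrable_mult_of_squares[OF m u v]
  define a b c where "a = (\<integral>x. (u x)\<^sup>2 \<partial>M)" "b = (\<integral>x. u x * v x \<partial>M)" "c = (\<integral>x. (v x)\<^sup>2 \<partial>M)"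
  have q: "0 \<le> s\<^sup>2 * a - 2 * s * t * b + t\<^sup>2 * c" for s t
  proof -
    have "0 \<le> (\<integral>x. (s * u x - t * v x)\<^sup>2 \<partial>M)"
      by simp
    also have "(\<integral>x. (s * u x - t * v x)\<^sup>2 \<partial>M) =
        (\<integral>x. s\<^sup>2 * (u x)\<^sup>2 - 2 * s * t * (u x * v x) + t\<^sup>2 * (v x)\<^sup>2 \<partial>M)"
      by (intro Bochner_Integration.integral_cong) (auto simp: power2_eq_square algebra_simps)
    also have "\<dots> = s\<^sup>2 * a - 2 * s * t * b + t\<^sup>2 * c"
      using u v uv by (simp add: a_b_c_def)
    finally show ?thesis .
  qed
  have "b\<^sup>2 \<le> a * c"
  proof (cases "c = 0")
    case True
    have "b = 0"
    proof (rule ccontr)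
      assume "b \<noteq> 0"
      \<comment> \<open>With c = 0 this t gives the form the value a - (a + 1) = -1.\<close>
      with q[of 1 "(a + 1) / (2 * b)"] True show False
        by (simp add: field_simps)
    qed
    then show ?thesis by (simp add: True)
  next
    case False
    then have "c > 0" by (smt (verit, best) a_b_c_def(3) integral_nonneg_AE AE_I2 zero_le_power2)
    have "0 \<le> c * (a * c - b\<^sup>2)"
      using q[of c b] by (simp add: power2_eq_square algebra_simps)
    with \<open>c > 0\<close> show ?thesis by (simp add: zero_le_mult_iff)
  qed
  then show ?thesis by (simp add: a_b_c_def)
qed

text \<open>With s = sqrt p, the inequality ln x \<le> x - 1 at s and at 1/s limits the growth of ln
  p to sqrt p for large p and to 1 / sqrt p for small p. The bound is linear in \<open>p\<close>, so
  the L1 norm of the estimator controls the L2 norm of the coefficient 1 + ln p.\<close>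

lemma one_plus_ln_sq_le:
  fixes p \<gamma> :: real
  assumes "0 < \<gamma>" "\<gamma> \<le> 1" "\<gamma> \<le> p"
  shows "(1 + ln p)\<^sup>2 \<le> 4 * p / \<gamma>\<^sup>2"
proof -
  have p: "p > 0" using assms by simp
  define s where "s = sqrt p"
  have s: "s > 0" "p = s\<^sup>2" using p by (auto simp: s_def)
  have ln: "ln p = 2 * ln s" using s by (simp add: ln_realpow)
  have up: "ln s \<le> s - 1" using s ln_le_minus_one by auto
  have lo: "- ln s \<le> 1 / s - 1" using ln_le_minus_one[of "1/s"] s by (simp add: ln_div)
  show ?thesis
  proof (cases "p \<ge> 1")
    case True
    then have "0 \<le> ln p" by simp
    with up ln have "0 \<le> 1 + ln p" "1 + ln p \<le> 2 * s" by auto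
    then have "(1 + ln p)\<^sup>2 \<le> (2 * s)\<^sup>2" by (rule power_mono[rotated])
    also have "\<dots> = 4 * p / 1" by (simp add: s power_mult_distrib)
    also have "\<dots> \<le> 4 * p / \<gamma>\<^sup>2" using assms p
      by (intro divide_left_mono) (auto simp: power_le_one)
    finally show ?thesis .
  next
    case False
    then have "ln p \<le> 0" "s \<le> 1" using p by (auto simp: s_def)
    then have "1 / s \<ge> 1" using s by auto
    have "\<bar>1 + ln p\<bar> \<le> 2 / s" using lo ln \<open>ln p \<le> 0\<close> \<open>1 / s \<ge> 1\<close> by (auto simp: abs_if)
    then have "(1 + ln p)\<^sup>2 \<le> (2 / s)\<^sup>2" using s by (auto simp: abs_le_square_iff[symmetric])
    also have "\<dots> = 4 * (1 / p)" by (simp add: s power_divide)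
    also have "1 / p \<le> p / \<gamma>\<^sup>2"
      using assms p power_mono[of \<gamma> p 2] by (simp add: field_simps power2_eq_square)
    finally show ?thesis by simp
  qed
qed

text \<open>This is the Bregman remainder of y ln y at \<open>p\<close>, the integrand of a
  generalised Kullback-Leibler divergence. Applying ln x \<le> x - 1 to p / f gives its sign, and to
  f / p the chi-square bound.\<close>

lemma entropy_remainder_bounds:
  fixes f p :: real
  assumes "f \<ge> 0" "p > 0"
  shows "0 \<le> f * ln f - f * ln p - f + p" "f * ln f - f * ln p - f + p \<le> (f - p)\<^sup>2 / p"
proof -
  have "0 \<le> f * ln f - f * ln p - f + p \<and> f * ln f - f * ln p - f + p \<le> (f - p)\<^sup>2 / p"
  proof (cases "f = 0")
    case True
    then show ?thesis using assms by (simp add: power2_eq_square)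
  next
    case False
    then have f: "f > 0" using assms by simp
    have "ln p - ln f \<le> p / f - 1"
      using ln_le_minus_one[of "p/f"] f assms by (simp add: ln_div)
    then have "f * (ln p - ln f) \<le> f * (p / f - 1)" using f by (intro mult_left_mono) auto
    moreover have "f * (p / f - 1) = p - f" using f by (simp add: field_simps)
    moreover have "ln f - ln p \<le> f / p - 1"
      using ln_le_minus_one[of "f/p"] f assms by (simp add: ln_div)
    then have "f * (ln f - ln p) \<le> f * (f / p - 1)" using f by (intro mult_left_mono) auto
    moreover have "f * (f / p - 1) - f + p = (f - p)\<^sup>2 / p"
      using assms by (simp add: field_simps power2_eq_square)
    ultimately show ?thesis by (auto simp: algebra_simps)
  qed
  then show "0 \<le> f * ln f - f * ln p - f + p" "f * ln f - f * ln p - f + p \<le> (f - p)\<^sup>2 / p"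
    by auto
qed

text \<open>
  On \<open>{p \<ge> \<gamma>}\<close> one has \<open>f ln f - p ln p = (1 + ln p) (f - p) + r\<close> with \<open>0 \<le> r \<le> (f - p)\<^sup>2 / p\<close>.
  The linear part is handled by Cauchy--Schwarz. The integral of \<open>r\<close> is at most \<open>ISE / \<gamma>\<close>, but also
  \<open>O(1 / \<gamma>)\<close>, and the product of these two bounds controls its square by the first power of \<open>ISE\<close>.
\<close>

lemma truncated_entropy_diff_sq_le:
  fixes f p :: "real \<Rightarrow> real"
  assumes f: "integrable lborel f" "\<And>x. f x \<ge> 0" "(\<integral>x. f x \<partial>lborel) = 1"
    and F: "AE x in lborel. f x \<le> F" "F \<ge> 0"
    and fl: "integrable lborel (\<lambda>x. f x * ln (f x))"
    and p: "integrable lborel p" "(\<integral>x. \<bar>p x\<bar> \<partial>lborel) \<le> L"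
    and D: "integrable lborel (\<lambda>x. (p x - f x)\<^sup>2)"
    and \<gamma>: "0 < \<gamma>" "\<gamma> \<le> 1"
  shows "((- (LINT x:{x. \<gamma> \<le> p x}|lborel. p x * ln (p x)))
            - (LINT x:{x. \<gamma> \<le> p x}|lborel. (- ln (f x)) * f x))\<^sup>2
         \<le> (12 * L + 4 * F) / \<gamma>\<^sup>2 * (\<integral>x. (p x - f x)\<^sup>2 \<partial>lborel)"
proof -
  define I where "I = (\<integral>x. (p x - f x)\<^sup>2 \<partial>lborel)"
  define A where "A = {x. \<gamma> \<le> p x}"
  have [measurable]: "f \<in> borel_measurable borel" "p \<in> borel_measurable borel"
    using f(1) p(1) by auto
  have [measurable]: "A \<in> sets borel" unfolding A_def by measurable
  define \<xi> :: "real \<Rightarrow> real" where "\<xi> = indicator A"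
  have [measurable]: "\<xi> \<in> borel_measurable borel" unfolding \<xi>_def by measurable
  have \<xi>: "\<xi> x = 0 \<or> \<xi> x = 1 \<and> \<gamma> \<le> p x \<and> p x > 0" for x
    using \<gamma> by (auto simp: \<xi>_def A_def indicator_def)
  define l where "l x = \<xi> x * (1 + ln (p x))" for x
  define r where "r x = \<xi> x * (f x * ln (f x) - f x * ln (p x) - f x + p x)" for x
  have [measurable]: "l \<in> borel_measurable borel" "r \<in> borel_measurable borel"
    unfolding l_def r_def by measurable
  have L: "L \<ge> 0" using p(2) by (smt (verit) integral_nonneg_AE AE_I2 abs_ge_zero)
  have I: "I \<ge> 0" by (simp add: I_def)
  have l2: "(l x)\<^sup>2 \<le> 4 / \<gamma>\<^sup>2 * \<bar>p x\<bar>" for x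
    using \<xi>[of x] one_plus_ln_sq_le[OF \<gamma>, of "p x"] \<gamma> by (auto simp: l_def)
  have l2_int: "integrable lborel (\<lambda>x. (l x)\<^sup>2)"
    by (rule Bochner_Integration.integrable_bound[of _ "\<lambda>x. 4 / \<gamma>\<^sup>2 * \<bar>p x\<bar>"])
       (use p l2 \<gamma> in auto)
  have l2_le: "(\<integral>x. (l x)\<^sup>2 \<partial>lborel) \<le> 4 * L / \<gamma>\<^sup>2"
  proof -
    have "(\<integral>x. (l x)\<^sup>2 \<partial>lborel) \<le> (\<integral>x. 4 / \<gamma>\<^sup>2 * \<bar>p x\<bar> \<partial>lborel)"
      using p l2 l2_int by (intro integral_mono) auto
    also have "\<dots> \<le> 4 / \<gamma>\<^sup>2 * L" using p(2) \<gamma> by (simp add: divide_right_mono)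
    finally show ?thesis by simp
  qed
  have D': "integrable lborel (\<lambda>x. (f x - p x)\<^sup>2)" "(\<integral>x. (f x - p x)\<^sup>2 \<partial>lborel) = I"
    using D by (auto simp: power2_commute I_def)
  have r0: "0 \<le> r x" and r1: "r x \<le> (f x - p x)\<^sup>2 / \<gamma>" for x
  proof -
    show "0 \<le> r x" using \<xi>[of x] entropy_remainder_bounds(1)[OF f(2), of "p x" x] by (auto simp: r_def)
    have "(f x - p x)\<^sup>2 / p x \<le> (f x - p x)\<^sup>2 / \<gamma>" if "\<gamma> \<le> p x"
      using that \<gamma> by (intro divide_left_mono) auto
    then show "r x \<le> (f x - p x)\<^sup>2 / \<gamma>"
      using \<xi>[of x] entropy_remainder_bounds(2)[OF f(2), of "p x" x] \<gamma> by (force simp: r_def)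
  qed
  \<comment> \<open>A bound free of the ISE: (f - p)^2 / p is at most 2 f^2 / p + 2 p, and f^2 / p
    \<le> F f / \<gamma>. It holds almost everywhere because \<open>f\<close> is bounded by
    \<open>F\<close> only in that sense.\<close>
  have r2: "AE x in lborel. r x \<le> 2 * F / \<gamma> * f x + 2 * \<bar>p x\<bar>"
    using F(1)
  proof eventually_elim
    case (elim x)
    show ?case
    proof (cases "\<xi> x = 0")
      case True
      then show ?thesis using f(2)[of x] F \<gamma> by (simp add: r_def)
    next
      case False
      then have c: "\<xi> x = 1" "\<gamma> \<le> p x" "p x > 0" using \<xi>[of x] by auto
      have "r x \<le> (f x - p x)\<^sup>2 / p x"
        using c entropy_remainder_bounds(2)[OF f(2), of "p x" x] by (simp add: r_def)
      also have "\<dots> \<le> (2 * (f x)\<^sup>2 + 2 * (p x)\<^sup>2) / p x"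
        using c sum_squares_bound[of "f x" "- p x"]
        by (intro divide_right_mono) (auto simp: power2_diff)
      also have "\<dots> = 2 * (f x)\<^sup>2 / p x + 2 * p x"
        using c by (simp add: field_simps power2_eq_square)
      also have "2 * (f x)\<^sup>2 / p x \<le> 2 * (F * f x) / \<gamma>"
        using c elim f(2)[of x] F \<gamma>
        by (intro frac_le) (auto simp: power2_eq_square intro: mult_right_mono)
      finally show ?thesis using c by simp
    qed
  qed
  have r_int: "integrable lborel r"
    by (rule Bochner_Integration.integrable_bound[of _ "\<lambda>x. (f x - p x)\<^sup>2 / \<gamma>"])
       (use r0 r1 D' \<gamma> in auto)
  define R where "R = (\<integral>x. r x \<partial>lborel)"
  have R0: "0 \<le> R" using r0 by (simp add: R_def)
  have R1: "R \<le> I / \<gamma>"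
  proof -
    have "R \<le> (\<integral>x. (f x - p x)\<^sup>2 / \<gamma> \<partial>lborel)"
      unfolding R_def using r_int D' r1 by (intro integral_mono) auto
    then show ?thesis using D' by simp
  qed
  have R2: "R \<le> (2 * F + 2 * L) / \<gamma>"
  proof -
    have "R \<le> (\<integral>x. 2 * F / \<gamma> * f x + 2 * \<bar>p x\<bar> \<partial>lborel)"
      unfolding R_def using r_int f p r2 by (intro integral_mono_AE) auto
    also have "\<dots> = 2 * F / \<gamma> + 2 * (\<integral>x. \<bar>p x\<bar> \<partial>lborel)"
      using f p by simp
    also have "\<dots> \<le> 2 * F / \<gamma> + 2 * L" using p by simp
    also have "2 * L \<le> 2 * L / \<gamma>" using L \<gamma> mult_left_le[of \<gamma> "2 * L"] by (simp add: pos_le_divide_eq)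
    finally show ?thesis by (simp add: add_divide_distrib)
  qed
  have Rsq: "R\<^sup>2 \<le> (2 * F + 2 * L) / \<gamma>\<^sup>2 * I"
  proof -
    have "R * R \<le> (I / \<gamma>) * ((2 * F + 2 * L) / \<gamma>)"
      using R0 R1 R2 I \<gamma> by (intro mult_mono) auto
    then show ?thesis by (simp add: power2_eq_square field_simps)
  qed
  define E where "E = (\<integral>x. l x * (f x - p x) \<partial>lborel)"
  have E_int: "integrable lborel (\<lambda>x. l x * (f x - p x))"
    using l2_int D' by (intro integrable_mult_of_squares) auto
  have "E\<^sup>2 \<le> (\<integral>x. (l x)\<^sup>2 \<partial>lborel) * I"
    unfolding E_def D'(2)[symmetric] using l2_int D' by (intro integral_Cauchy_Schwarz) auto
  also have "\<dots> \<le> 4 * L / \<gamma>\<^sup>2 * I" using l2_le I by (rule mult_right_mono)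
  finally have Esq: "E\<^sup>2 \<le> 4 * L / \<gamma>\<^sup>2 * I" .
  have \<xi>f_int: "integrable lborel (\<lambda>x. \<xi> x * (f x * ln (f x)))"
    by (rule Bochner_Integration.integrable_bound[OF fl]) (auto simp: \<xi>_def indicator_def)
  have decomp: "\<xi> x * (p x * ln (p x)) = \<xi> x * (f x * ln (f x)) - l x * (f x - p x) - r x" for x
    by (simp add: l_def r_def algebra_simps)
  have "(LINT x:A|lborel. p x * ln (p x)) = (\<integral>x. \<xi> x * (p x * ln (p x)) \<partial>lborel)"
    by (simp add: set_lebesgue_integral_def \<xi>_def)
  also have "\<dots> = (\<integral>x. \<xi> x * (f x * ln (f x)) \<partial>lborel) - E - R"
    unfolding decomp E_def R_def using \<xi>f_int E_int r_int by simp
  finally have 1: "(LINT x:A|lborel. p x * ln (p x)) = (\<integral>x. \<xi> x * (f x * ln (f x)) \<partial>lborel) - E - R" .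
  have 2: "(LINT x:A|lborel. (- ln (f x)) * f x) = - (\<integral>x. \<xi> x * (f x * ln (f x)) \<partial>lborel)"
    by (simp add: set_lebesgue_integral_def \<xi>_def mult.commute[of "ln _"])
  have "((- (LINT x:A|lborel. p x * ln (p x))) - (LINT x:A|lborel. (- ln (f x)) * f x))\<^sup>2 = (E + R)\<^sup>2"
    unfolding 1 2 by (simp add: add.commute)
  also have "\<dots> \<le> 2 * E\<^sup>2 + 2 * R\<^sup>2"
    using sum_squares_bound[of E R] by (simp add: power2_sum)
  \<comment> \<open>The linear part contributes 8 L to the final constant, the remainder 4 F + 4
    L.\<close>
  also have "\<dots> \<le> 2 * (4 * L / \<gamma>\<^sup>2 * I) + 2 * ((2 * F + 2 * L) / \<gamma>\<^sup>2 * I)"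
    using Esq Rsq by simp
  also have "\<dots> = (12 * L + 4 * F) / \<gamma>\<^sup>2 * I"
    by (simp add: add_divide_distrib distrib_right distrib_left mult.commute mult.left_commute)
  finally show ?thesis unfolding A_def I_def .
qed

section \<open>Smoothing bias\<close>

lemma continuous_on_of_real_derivative:
  fixes g :: "real \<Rightarrow> real"
  assumes "\<And>x. (g has_real_derivative g1 x) (at x)"
  shows "continuous_on A g"
  by (rule DERIV_continuous_on[OF has_field_derivative_at_within[OF assms]])

text \<open>A derivative is the pointwise limit of difference quotients with step 1/(n+1). Second
  derivatives are not assumed continuous, so their measurability has to come from here.\<close>

lemma borel_measurable_real_derivative:
  fixes g :: "real \<Rightarrow> real"
  assumes d: "\<And>x. (g has_real_derivative g1 x) (at x)"
  shows "g1 \<in> borel_measurable borel"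
proof (rule borel_measurable_LIMSEQ_real)
  have [measurable]: "g \<in> borel_measurable borel"
    using continuous_on_of_real_derivative[OF d] by (rule borel_measurable_continuous_onI)
  show "(\<lambda>x. (g (x + 1 / Suc n) - g x) / (1 / Suc n)) \<in> borel_measurable borel" for n
    by measurable
  fix x
  have "((\<lambda>s. (g (x + s) - g x) / s) \<longlongrightarrow> g1 x) (at 0)"
    using d[of x] by (simp add: DERIV_def)
  moreover have "filterlim (\<lambda>n. 1 / real (Suc n)) (at 0) sequentially"
    using LIMSEQ_inverse_real_of_nat
    by (auto simp: filterlim_at inverse_eq_divide)
  ultimately show "(\<lambda>n. (g (x + 1 / Suc n) - g x) / (1 / Suc n)) \<longlonglongrightarrow> g1 x"
    by (rule filterlim_compose)
qed

text \<open>The mean value theorem reduces the remainder to t (g1 \<xi> - g1 y), and Cauchy-Schwarz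
  against the indicator of the window bounds this increment by the local L2 mass of
  \<open>g2\<close>. The window depends on \<rho> but not on \<open>t\<close>, so one bound serves
  all shifts within the support of the kernel.\<close>

lemma Taylor_remainder_sq_le:
  fixes g g1 g2 :: "real \<Rightarrow> real"
  assumes d1: "\<And>x. (g has_real_derivative g1 x) (at x)"
    and d2: "\<And>x. (g1 has_real_derivative g2 x) (at x)"
    and g2: "integrable lborel (\<lambda>x. (g2 x)\<^sup>2)"
    and t: "\<bar>t\<bar> \<le> \<rho>"
  shows "(g (y + t) - g y - t * g1 y)\<^sup>2
         \<le> \<rho>\<^sup>2 * (2 * \<rho> * (\<integral>w. indicator {y-\<rho>..y+\<rho>} w * (g2 w)\<^sup>2 \<partial>lborel))"
proof -
  have [measurable]: "g2 \<in> borel_measurable borel"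
    by (rule borel_measurable_real_derivative[OF d2])
  define S where "S = {y-\<rho>..y+\<rho>}"
  have \<rho>: "\<rho> \<ge> 0" using t by linarith
  define i :: "real \<Rightarrow> real" where "i = indicator S"
  have [measurable]: "i \<in> borel_measurable borel" unfolding i_def S_def by measurable
  have i2: "(\<lambda>w. (i w)\<^sup>2) = i" by (auto simp: i_def indicator_def fun_eq_iff)
  have i_int: "integrable lborel i"
    unfolding i_def S_def by (intro integrable_real_indicator) (auto simp: emeasure_lborel_Icc_eq)
  have i_val: "(\<integral>w. i w \<partial>lborel) = 2 * \<rho>"
    using \<rho> by (simp add: i_def S_def)
  have ig2: "integrable lborel (\<lambda>w. (i w * \<bar>g2 w\<bar>)\<^sup>2)"
    by (rule Bochner_Integration.integrable_bound[OF g2], measurable) (auto simp: i_def indicator_def)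
  define Q where "Q = (\<integral>w. i w * \<bar>g2 w\<bar> \<partial>lborel)"
  have eq: "(\<lambda>w. i w * (i w * \<bar>g2 w\<bar>)) = (\<lambda>w. i w * \<bar>g2 w\<bar>)"
    by (auto simp: i_def indicator_def fun_eq_iff)
  have abs_int: "integrable lborel (\<lambda>w. i w * \<bar>g2 w\<bar>)"
    using integrable_mult_of_squares[of i lborel "\<lambda>w. i w * \<bar>g2 w\<bar>"] i_int ig2
    by (simp add: i2 eq)
  have Q0: "0 \<le> Q" unfolding Q_def by (auto simp: i_def)
  have eq2: "(\<lambda>w. (i w * \<bar>g2 w\<bar>)\<^sup>2) = (\<lambda>w. i w * (g2 w)\<^sup>2)"
    by (auto simp: i_def indicator_def fun_eq_iff)
  have Q2: "Q\<^sup>2 \<le> 2 * \<rho> * (\<integral>w. i w * (g2 w)\<^sup>2 \<partial>lborel)"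
    using integral_Cauchy_Schwarz[of i lborel "\<lambda>w. i w * \<bar>g2 w\<bar>"] i_int ig2
    by (simp add: i2 eq i_val Q_def eq2)
  \<comment> \<open>The fundamental theorem holds for the gauge integral of any derivative. Square
    integrability makes \<open>g2\<close> Lebesgue integrable on the window, where the two integrals
    agree.\<close>
  have step: "\<bar>g1 b - g1 a\<bar> \<le> Q" if ab: "a \<le> b" "{a..b} \<subseteq> S" for a b
  proof -
    have "(g2 has_integral (g1 b - g1 a)) {a..b}"
      using ab d2
      by (intro fundamental_theorem_of_calculus)
         (auto simp: has_real_derivative_iff_has_vector_derivative[symmetric]
               intro: DERIV_subset)
    moreover have si: "set_integrable lborel {a..b} g2"
      unfolding set_integrable_def
      by (rule Bochner_Integration.integrable_bound[OF abs_int])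
         (use ab in \<open>auto simp: i_def indicator_def subset_iff\<close>)
    ultimately have "g1 b - g1 a = (\<integral>w. indicator {a..b} w * g2 w \<partial>lborel)"
      using set_borel_integral_eq_integral(2)[OF si]
      by (simp add: integral_unique set_lebesgue_integral_def)
    also have "\<bar>\<dots>\<bar> \<le> (\<integral>w. \<bar>indicator {a..b} w * g2 w\<bar> \<partial>lborel)"
      by (rule integral_abs_bound)
    also have "\<dots> \<le> Q"
      unfolding Q_def
    proof (rule integral_mono)
      show "integrable lborel (\<lambda>w. \<bar>indicator {a..b} w * g2 w\<bar>)"
        using si by (intro integrable_abs) (simp add: set_integrable_def)
      show "\<bar>indicator {a..b} w * g2 w\<bar> \<le> i w * \<bar>g2 w\<bar>" for w
        using ab by (auto simp: i_def indicator_def)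
    qed (rule abs_int)
    finally show ?thesis .
  qed
  have step': "\<bar>g1 \<xi> - g1 y\<bar> \<le> Q" if "\<bar>\<xi> - y\<bar> \<le> \<rho>" for \<xi>
  proof (cases "y \<le> \<xi>")
    case True
    then show ?thesis using that by (intro step) (auto simp: S_def)
  next
    case False
    then have "\<bar>g1 y - g1 \<xi>\<bar> \<le> Q" using that by (intro step) (auto simp: S_def)
    then show ?thesis by linarith
  qed
  have mvt: "\<exists>\<xi>. \<bar>\<xi> - y\<bar> \<le> \<rho> \<and> g (y + t) - g y = t * g1 \<xi>"
  proof (cases t "0::real" rule: linorder_cases)
    case less
    then obtain z where "y + t < z" "z < y" "g y - g (y + t) = (y - (y + t)) * g1 z"
      using MVT2[of "y + t" y g g1] d1 by auto
    then show ?thesis using t by (intro exI[of _ z]) auto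
  next
    case equal
    then show ?thesis using \<rho> by (intro exI[of _ y]) auto
  next
    case greater
    then obtain z where "y < z" "z < y + t" "g (y + t) - g y = (y + t - y) * g1 z"
      using MVT2[of y "y + t" g g1] d1 by auto
    then show ?thesis using t by (intro exI[of _ z]) auto
  qed
  then obtain \<xi> where \<xi>: "\<bar>\<xi> - y\<bar> \<le> \<rho>" "g (y + t) - g y = t * g1 \<xi>" by blast
  have "\<bar>g (y + t) - g y - t * g1 y\<bar> = \<bar>t\<bar> * \<bar>g1 \<xi> - g1 y\<bar>"
    unfolding \<xi>(2) abs_mult[symmetric] by (simp add: algebra_simps)
  also have "\<dots> \<le> \<rho> * Q" using t step'[OF \<xi>(1)] \<rho> by (intro mult_mono) auto
  also have "\<dots> = \<bar>\<rho> * Q\<bar>" using \<rho> Q0 by simp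
  finally have "(g (y + t) - g y - t * g1 y)\<^sup>2 \<le> (\<rho> * Q)\<^sup>2"
    unfolding abs_le_square_iff .
  also have "\<dots> \<le> \<rho>\<^sup>2 * (2 * \<rho> * (\<integral>w. i w * (g2 w)\<^sup>2 \<partial>lborel))"
    using Q2 by (simp add: power_mult_distrib mult_left_mono)
  finally show ?thesis by (simp add: i_def S_def)
qed

text \<open>By Tonelli, each \<open>w\<close> is counted for those \<open>y\<close> that form an
  interval of length 2 \<rho>.\<close>

lemma nn_integral_window:
  fixes G :: "real \<Rightarrow> real"
  assumes G: "integrable lborel G" "\<And>w. G w \<ge> 0" and \<rho>: "\<rho> \<ge> 0"
  shows "(\<integral>\<^sup>+y. ennreal (\<integral>w. indicator {y-\<rho>..y+\<rho>} w * G w \<partial>lborel) \<partial>lborel)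
         = ennreal (2 * \<rho> * (\<integral>w. G w \<partial>lborel))"
proof -
  have [measurable]: "G \<in> borel_measurable borel" using G by auto
  have "(\<integral>\<^sup>+y. ennreal (\<integral>w. indicator {y-\<rho>..y+\<rho>} w * G w \<partial>lborel) \<partial>lborel)
      = (\<integral>\<^sup>+y. (\<integral>\<^sup>+w. indicator {y-\<rho>..y+\<rho>} w * ennreal (G w) \<partial>lborel) \<partial>lborel)"
  proof (rule nn_integral_cong)
    fix y
    have "integrable lborel (\<lambda>w. indicator {y-\<rho>..y+\<rho>} w * G w)"
      by (rule Bochner_Integration.integrable_bound[OF G(1)]) (auto simp: indicator_def)
    then have "ennreal (\<integral>w. indicator {y-\<rho>..y+\<rho>} w * G w \<partial>lborel)
        = (\<integral>\<^sup>+w. ennreal (indicator {y-\<rho>..y+\<rho>} w * G w) \<partial>lborel)"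
      using G by (intro nn_integral_eq_integral[symmetric]) auto
    then show "ennreal (\<integral>w. indicator {y-\<rho>..y+\<rho>} w * G w \<partial>lborel)
        = (\<integral>\<^sup>+w. indicator {y-\<rho>..y+\<rho>} w * ennreal (G w) \<partial>lborel)"
      by (simp add: ennreal_mult' ennreal_indicator)
  qed
  also have "\<dots> = (\<integral>\<^sup>+w. (\<integral>\<^sup>+y. indicator {p. fst p - \<rho> \<le> snd p \<and> snd p \<le> fst p + \<rho>} (y, w) * ennreal (G w) \<partial>lborel) \<partial>lborel)"
  proof -
    \<comment> \<open>Rewriting membership as a fixed set in the plane exposes joint measurability
      in \<open>y\<close> and \<open>w\<close>.\<close>
    have 1: "(indicator {y-\<rho>..y+\<rho>} w :: ennreal) = indicator {p. fst p - \<rho> \<le> snd p \<and> snd p \<le> fst p + \<rho>} (y, w)" for y w :: real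
      by (auto simp: indicator_def)
    show ?thesis
      unfolding 1 by (rule lborel_pair.Fubini'[symmetric], measurable)
  qed
  also have "\<dots> = (\<integral>\<^sup>+w. ennreal (2 * \<rho>) * ennreal (G w) \<partial>lborel)"
  proof (rule nn_integral_cong)
    fix w
    have "(\<integral>\<^sup>+y. indicator {p. fst p - \<rho> \<le> snd p \<and> snd p \<le> fst p + \<rho>} (y, w) * ennreal (G w) \<partial>lborel)
        = (\<integral>\<^sup>+y. indicator {w-\<rho>..w+\<rho>} y * ennreal (G w) \<partial>lborel)"
      by (intro nn_integral_cong) (auto simp: indicator_def)
    also have "\<dots> = ennreal (2 * \<rho>) * ennreal (G w)"
      using \<rho> by (simp add: nn_integral_multc)
    finally show "(\<integral>\<^sup>+y. indicator {p. fst p - \<rho> \<le> snd p \<and> snd p \<le> fst p + \<rho>} (y, w) * ennreal (G w) \<partial>lborel)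
        = ennreal (2 * \<rho>) * ennreal (G w)" .
  qed
  also have "\<dots> = ennreal (2 * \<rho>) * (\<integral>\<^sup>+w. ennreal (G w) \<partial>lborel)"
    by (rule nn_integral_cmult) auto
  also have "\<dots> = ennreal (2 * \<rho> * (\<integral>w. G w \<partial>lborel))"
    using G \<rho> by (simp add: nn_integral_eq_integral ennreal_mult)
  finally show ?thesis .
qed

lemma integrable_mult_bounded:
  fixes k u :: "'b \<Rightarrow> real"
  assumes "integrable M k" "u \<in> borel_measurable M" "\<And>x. \<bar>u x\<bar> \<le> B"
  shows "integrable M (\<lambda>x. k x * u x)"
proof (rule Bochner_Integration.integrable_bound[of _ "\<lambda>x. B * k x"])
  have "\<bar>u x\<bar> * \<bar>k x\<bar> \<le> \<bar>B\<bar> * \<bar>k x\<bar>" for x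
    using assms(3)[of x] by (intro mult_right_mono) auto
  then show "AE x in M. norm (k x * u x) \<le> norm (B * k x)"
    by (simp add: abs_mult mult.commute)
qed (use assms in auto)

text \<open>The vanishing first moment cancels the linear Taylor term. The squared remainder costs
  \<rho>^3 times the local L2 mass of \<open>g2\<close>, and integrating that mass over all windows
  supplies the fourth factor \<rho>.\<close>

lemma smoothing_bias_L2:
  fixes g g1 g2 \<kappa> :: "real \<Rightarrow> real"
  assumes d1: "\<And>x. (g has_real_derivative g1 x) (at x)"
    and d2: "\<And>x. (g1 has_real_derivative g2 x) (at x)"
    and g2: "integrable lborel (\<lambda>x. (g2 x)\<^sup>2)"
    and gB: "\<And>x. \<bar>g x\<bar> \<le> B"
    and \<kappa>: "integrable lborel \<kappa>" "(\<integral>u. \<kappa> u \<partial>lborel) = 1" "(\<integral>u. u * \<kappa> u \<partial>lborel) = 0"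
    and supp: "\<And>u. \<bar>u\<bar> > \<rho> \<Longrightarrow> \<kappa> u = 0" and \<rho>: "\<rho> \<ge> 0"
  shows "(\<integral>\<^sup>+y. ennreal (((\<integral>u. \<kappa> u * g (y - u) \<partial>lborel) - g y)\<^sup>2) \<partial>lborel)
    \<le> ennreal (4 * (\<integral>u. \<bar>\<kappa> u\<bar> \<partial>lborel)\<^sup>2 * \<rho> ^ 4 * (\<integral>x. (g2 x)\<^sup>2 \<partial>lborel))"
proof -
  have [measurable]: "g \<in> borel_measurable borel"
    using continuous_on_of_real_derivative[OF d1] by (rule borel_measurable_continuous_onI)
  have [measurable]: "\<kappa> \<in> borel_measurable borel" using \<kappa> by auto
  define L where "L = (\<integral>u. \<bar>\<kappa> u\<bar> \<partial>lborel)"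
  have L: "L \<ge> 0" by (simp add: L_def)
  define Q where "Q y = (\<integral>w. indicator {y-\<rho>..y+\<rho>} w * (g2 w)\<^sup>2 \<partial>lborel)" for y
  have Q0: "Q y \<ge> 0" for y unfolding Q_def by (auto intro!: integral_nonneg_AE)
  have [measurable]: "g2 \<in> borel_measurable borel"
    by (rule borel_measurable_real_derivative[OF d2])
  have bound: "((\<integral>u. \<kappa> u * g (y - u) \<partial>lborel) - g y)\<^sup>2 \<le> 2 * L\<^sup>2 * \<rho> ^ 3 * Q y" for y
  proof -
    have i1: "integrable lborel (\<lambda>u. \<kappa> u * g (y - u))"
      using gB by (intro integrable_mult_bounded[OF \<kappa>(1)]) auto
    have i2: "integrable lborel (\<lambda>u. u * \<kappa> u)"
    proof (rule Bochner_Integration.integrable_bound[of _ "\<lambda>u. \<rho> * \<kappa> u"])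
      have "\<bar>u\<bar> * \<bar>\<kappa> u\<bar> \<le> \<rho> * \<bar>\<kappa> u\<bar>" for u
        using supp[of u] by (cases "\<bar>u\<bar> > \<rho>") (auto intro: mult_right_mono)
      then show "AE u in lborel. norm (u * \<kappa> u) \<le> norm (\<rho> * \<kappa> u)"
        using \<rho> by (simp add: abs_mult)
    qed (use \<kappa> in auto)
    \<comment> \<open>The square root of the Taylor bound at radius \<rho>; it depends on
      \<open>y\<close> but not on \<open>u\<close>.\<close>
    define c where "c = \<rho> * sqrt (2 * \<rho> * Q y)"
    have c0: "c \<ge> 0" using \<rho> Q0 by (simp add: c_def)
    have pt: "\<bar>\<kappa> u * g (y - u) - \<kappa> u * g y + g1 y * (u * \<kappa> u)\<bar> \<le> c * \<bar>\<kappa> u\<bar>" for u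
    proof (cases "\<bar>u\<bar> > \<rho>")
      case False
      have "(g (y + (-u)) - g y - (-u) * g1 y)\<^sup>2 \<le> c\<^sup>2"
        using Taylor_remainder_sq_le[OF d1 d2 g2, of "-u" \<rho> y] False \<rho> Q0
        by (simp add: c_def power_mult_distrib Q_def[symmetric])
      then have "\<bar>g (y - u) - g y + u * g1 y\<bar> \<le> c"
        using c0 by (simp add: abs_le_square_iff[symmetric])
      then have "\<bar>\<kappa> u\<bar> * \<bar>g (y - u) - g y + u * g1 y\<bar> \<le> \<bar>\<kappa> u\<bar> * c"
        by (rule mult_left_mono) auto
      then show ?thesis unfolding abs_mult[symmetric] by (simp add: algebra_simps)
    qed (simp add: supp)
    \<comment> \<open>The last term integrates to zero by the moment condition, and the middle one
      to \<open>g y\<close> because the kernel has mass one.\<close>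
    define T where "T u = \<kappa> u * g (y - u) - \<kappa> u * g y + g1 y * (u * \<kappa> u)" for u
    have T_int: "integrable lborel T"
      unfolding T_def
      by (rule Bochner_Integration.integrable_add[OF
            Bochner_Integration.integrable_diff[OF i1 integrable_mult_left[OF \<kappa>(1)]]
            integrable_mult_right[OF i2]])
    have T_eq: "(\<integral>u. \<kappa> u * g (y - u) \<partial>lborel) - g y = (\<integral>u. T u \<partial>lborel)"
      unfolding T_def using i1 i2 \<kappa> by simp
    have "\<bar>\<integral>u. T u \<partial>lborel\<bar> \<le> (\<integral>u. \<bar>T u\<bar> \<partial>lborel)"
      by (rule integral_abs_bound)
    also have "\<dots> \<le> (\<integral>u. c * \<bar>\<kappa> u\<bar> \<partial>lborel)"
    proof (rule integral_mono)
      show "integrable lborel (\<lambda>u. \<bar>T u\<bar>)"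
        using T_int by (rule integrable_abs)
      show "integrable lborel (\<lambda>u. c * \<bar>\<kappa> u\<bar>)"
        using \<kappa>(1) by (intro integrable_mult_right integrable_abs)
    qed (use pt in \<open>simp add: T_def\<close>)
    also have "\<dots> = \<bar>c * L\<bar>" using c0 by (simp add: L_def)
    finally have "((\<integral>u. \<kappa> u * g (y - u) \<partial>lborel) - g y)\<^sup>2 \<le> (c * L)\<^sup>2"
      unfolding T_eq abs_le_square_iff .
    also have "\<dots> = 2 * L\<^sup>2 * \<rho> ^ 3 * Q y"
      using \<rho> Q0[of y] by (simp add: c_def power_mult_distrib power2_eq_square power3_eq_cube)
    finally show ?thesis .
  qed
  have [measurable]: "Q \<in> borel_measurable borel"
  proof -
    have eq: "indicator {y-\<rho>..y+\<rho>} w = (indicator {p. fst p - \<rho> \<le> snd p \<and> snd p \<le> fst p + \<rho>} (y, w) :: real)" for y w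
      by (auto simp: indicator_def)
    show ?thesis unfolding Q_def eq by measurable
  qed
  have "(\<integral>\<^sup>+y. ennreal (((\<integral>u. \<kappa> u * g (y - u) \<partial>lborel) - g y)\<^sup>2) \<partial>lborel)
      \<le> (\<integral>\<^sup>+y. ennreal (2 * L\<^sup>2 * \<rho> ^ 3) * ennreal (Q y) \<partial>lborel)"
    using bound Q0 \<rho> by (intro nn_integral_mono) (simp add: ennreal_mult[symmetric] ennreal_leI)
  also have "\<dots> = ennreal (2 * L\<^sup>2 * \<rho> ^ 3) * (\<integral>\<^sup>+y. ennreal (Q y) \<partial>lborel)"
    by (rule nn_integral_cmult) auto
  also have "(\<integral>\<^sup>+y. ennreal (Q y) \<partial>lborel) = ennreal (2 * \<rho> * (\<integral>x. (g2 x)\<^sup>2 \<partial>lborel))"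
    unfolding Q_def using nn_integral_window[OF g2 _ \<rho>] by simp
  also have "ennreal (2 * L\<^sup>2 * \<rho> ^ 3) * \<dots> = ennreal (4 * L\<^sup>2 * \<rho> ^ 4 * (\<integral>x. (g2 x)\<^sup>2 \<partial>lborel))"
    using \<rho> L by (subst ennreal_mult[symmetric])
      (auto simp: power2_eq_square power3_eq_cube power4_eq_xxxx algebra_simps)
  finally show ?thesis by (simp add: L_def)
qed

section \<open>Decoupling by replacement of innovations\<close>

definition bounded_borel :: "(real \<Rightarrow> real) \<Rightarrow> bool" where
  "bounded_borel \<phi> \<longleftrightarrow> \<phi> \<in> borel_measurable borel \<and> (\<exists>C. \<forall>x. \<bar>\<phi> x\<bar> \<le> C)"

text \<open>A derivative-free form of a bound \<open>B\<close> on the second derivative. It passes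
  through expectations and convolutions by linearity alone, without differentiation under the
  integral, and it is bilinear in the two increments.\<close>

definition second_difference_bound :: "real \<Rightarrow> (real \<Rightarrow> real) \<Rightarrow> bool" where
  "second_difference_bound B \<phi> \<longleftrightarrow>
     (\<forall>z s t. \<bar>\<phi> (z + s + t) - \<phi> (z + s) - \<phi> (z + t) + \<phi> z\<bar> \<le> B * \<bar>s\<bar> * \<bar>t\<bar>)"

lemma bounded_borelD:
  assumes "bounded_borel \<phi>"
  shows "\<phi> \<in> borel_measurable borel" "\<exists>C. \<forall>x. \<bar>\<phi> x\<bar> \<le> C"
  using assms by (auto simp: bounded_borel_def)

text \<open>The mixed difference is the increment over t of x \<mapsto> g (x + s) - g x, whose
  derivative g1 (x + s) - g1 x is at most B |s|. Two Lipschitz estimates suffice.\<close>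

lemma second_difference_bound_of_derivative:
  fixes g g1 g2 :: "real \<Rightarrow> real"
  assumes d1: "\<And>x. (g has_real_derivative g1 x) (at x)"
    and d2: "\<And>x. (g1 has_real_derivative g2 x) (at x)"
    and g2: "\<And>x. \<bar>g2 x\<bar> \<le> B"
  shows "second_difference_bound B g"
proof -
  have lip: "\<bar>u y - u x\<bar> \<le> C * \<bar>y - x\<bar>"
    if "\<And>x. (u has_real_derivative u' x) (at x)" "\<And>x. \<bar>u' x\<bar> \<le> C" for u u' :: "real \<Rightarrow> real" and C x y
    using field_differentiable_bound[of UNIV u u' C y x] that by (simp add: has_field_derivative_at_within)
  have "\<bar>g (z + s + t) - g (z + s) - g (z + t) + g z\<bar> \<le> B * \<bar>s\<bar> * \<bar>t\<bar>" for z s t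
  proof -
    have D: "((\<lambda>x. g (x + s) - g x) has_real_derivative (g1 (x + s) - g1 x)) (at x)" for x
      using DERIV_shift[of g "g1 (x + s)" x s] d1 by (intro DERIV_diff) auto
    have "\<bar>g1 (x + s) - g1 x\<bar> \<le> B * \<bar>s\<bar>" for x
      using lip[OF d2 g2, where y = "x + s" and x = x] by simp
    from lip[OF D this, where y = "z + t" and x = z] show ?thesis
      by (simp add: algebra_simps)
  qed
  then show ?thesis by (simp add: second_difference_bound_def)
qed

section \<open>Averaging bounded functions over independent variables\<close>

context prob_space
begin

lemma integrable_bounded:
  fixes X :: "'a \<Rightarrow> real"
  assumes "X \<in> borel_measurable M" "\<And>x. \<bar>X x\<bar> \<le> C"
  shows "integrable M X"
  by (rule integrable_const_bound[where B = C]) (use assms in auto)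

lemma expectation_abs_le:
  fixes X :: "'a \<Rightarrow> real"
  assumes "\<And>x. \<bar>X x\<bar> \<le> C"
  shows "\<bar>expectation X\<bar> \<le> C"
proof (cases "integrable M X")
  case True
  have "\<bar>expectation X\<bar> \<le> expectation (\<lambda>x. \<bar>X x\<bar>)" by (rule integral_abs_bound)
  also have "\<dots> \<le> expectation (\<lambda>_. C)" using True assms by (intro integral_mono) auto
  finally show ?thesis by (simp add: prob_space)
next
  \<comment> \<open>The Bochner integral of a non-integrable function is 0, and \<open>C\<close> is
    nonnegative because it dominates an absolute value.\<close>
  case False
  then show ?thesis using assms[of undefined] by (simp add: not_integrable_integral_eq)
qed

lemma bounded_borel_expectation_shift:
  assumes \<phi>: "bounded_borel \<phi>" and [measurable]: "S \<in> borel_measurable M"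
  shows "bounded_borel (\<lambda>z. expectation (\<lambda>\<omega>. \<phi> (z + S \<omega>)))"
proof -
  note [measurable] = bounded_borelD(1)[OF \<phi>]
  obtain C where "\<And>x. \<bar>\<phi> x\<bar> \<le> C" using bounded_borelD(2)[OF \<phi>] by auto
  then have "\<bar>expectation (\<lambda>\<omega>. \<phi> (z + S \<omega>))\<bar> \<le> C" for z
    by (intro expectation_abs_le)
  moreover have "(\<lambda>z. expectation (\<lambda>\<omega>. \<phi> (z + S \<omega>))) \<in> borel_measurable borel"
    by measurable
  ultimately show ?thesis unfolding bounded_borel_def by blast
qed

lemma second_difference_bound_expectation_shift:
  assumes \<phi>: "bounded_borel \<phi>" and [measurable]: "S \<in> borel_measurable M"
    and sd: "second_difference_bound B \<phi>"
  shows "second_difference_bound B (\<lambda>z. expectation (\<lambda>\<omega>. \<phi> (z + S \<omega>)))"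
  unfolding second_difference_bound_def
proof (intro allI)
  fix z s t
  note [measurable] = bounded_borelD(1)[OF \<phi>]
  obtain C where C: "\<And>x. \<bar>\<phi> x\<bar> \<le> C" using bounded_borelD(2)[OF \<phi>] by auto
  have i: "integrable M (\<lambda>\<omega>. \<phi> (x + S \<omega>))" for x
    by (rule integrable_bounded[OF _ C]) measurable
  have "expectation (\<lambda>\<omega>. \<phi> (z + s + t + S \<omega>)) - expectation (\<lambda>\<omega>. \<phi> (z + s + S \<omega>))
      - expectation (\<lambda>\<omega>. \<phi> (z + t + S \<omega>)) + expectation (\<lambda>\<omega>. \<phi> (z + S \<omega>))
      = expectation (\<lambda>\<omega>. \<phi> (z + s + t + S \<omega>) - \<phi> (z + s + S \<omega>) - \<phi> (z + t + S \<omega>) + \<phi> (z + S \<omega>))"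
    using i by simp
  moreover have "\<bar>expectation (\<lambda>\<omega>. \<phi> (z + s + t + S \<omega>) - \<phi> (z + s + S \<omega>) - \<phi> (z + t + S \<omega>) + \<phi> (z + S \<omega>))\<bar>
      \<le> B * \<bar>s\<bar> * \<bar>t\<bar>"
  proof (rule expectation_abs_le)
    fix \<omega>
    show "\<bar>\<phi> (z + s + t + S \<omega>) - \<phi> (z + s + S \<omega>) - \<phi> (z + t + S \<omega>) + \<phi> (z + S \<omega>)\<bar> \<le> B * \<bar>s\<bar> * \<bar>t\<bar>"
      using sd[unfolded second_difference_bound_def, rule_format, of "z + S \<omega>" s t]
      by (simp add: ac_simps)
  qed
  ultimately show "\<bar>expectation (\<lambda>\<omega>. \<phi> (z + s + t + S \<omega>)) - expectation (\<lambda>\<omega>. \<phi> (z + s + S \<omega>))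
      - expectation (\<lambda>\<omega>. \<phi> (z + t + S \<omega>)) + expectation (\<lambda>\<omega>. \<phi> (z + S \<omega>))\<bar> \<le> B * \<bar>s\<bar> * \<bar>t\<bar>"
    by simp
qed

text \<open>The two sample points range over separate copies of the space, so this is Fubini for
  arbitrary \<open>S\<close> and \<open>T\<close>, dependent or not. Nested expectations over
  \<open>M\<close> serve throughout as the encoding of an independent copy.\<close>

lemma expectation_shift_commute:
  assumes \<phi>: "bounded_borel \<phi>" and [measurable]: "S \<in> borel_measurable M" "T \<in> borel_measurable M"
  shows "expectation (\<lambda>\<omega>. expectation (\<lambda>\<omega>'. \<phi> (z + S \<omega> + T \<omega>')))
       = expectation (\<lambda>\<omega>'. expectation (\<lambda>\<omega>. \<phi> (z + T \<omega>' + S \<omega>)))"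
proof -
  interpret P: pair_prob_space M M ..
  note [measurable] = bounded_borelD(1)[OF \<phi>]
  obtain C where C: "\<And>x. \<bar>\<phi> x\<bar> \<le> C" using bounded_borelD(2)[OF \<phi>] by auto
  have "integrable (M \<Otimes>\<^sub>M M) (\<lambda>(\<omega>, \<omega>'). \<phi> (z + S \<omega> + T \<omega>'))"
    by (rule P.integrable_bounded[where C = C]) (use C in auto)
  from P.Fubini_integral[OF this] show ?thesis
    by (simp add: ac_simps)
qed

text \<open>Independence makes the joint law a product, so \<open>X\<close> can be redrawn in an
  inner integral while \<open>Y\<close> stays frozen.\<close>

lemma indep_var_nn_integral:
  assumes ind: "indep_var borel X borel Y"
    and [measurable]: "\<psi> \<in> borel_measurable (borel \<Otimes>\<^sub>M borel)"
  shows "(\<integral>\<^sup>+\<omega>. \<psi> (X \<omega>, Y \<omega>) \<partial>M) = (\<integral>\<^sup>+\<omega>. \<integral>\<^sup>+\<omega>'. \<psi> (X \<omega>', Y \<omega>) \<partial>M \<partial>M)"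
proof -
  have [measurable]: "X \<in> borel_measurable M" "Y \<in> borel_measurable M"
    and eq: "distr M borel X \<Otimes>\<^sub>M distr M borel Y = distr M (borel \<Otimes>\<^sub>M borel) (\<lambda>x. (X x, Y x))"
    using ind by (auto simp: indep_var_distribution_eq)
  interpret DX: prob_space "distr M borel X" by (rule prob_space_distr) simp
  interpret DY: prob_space "distr M borel Y" by (rule prob_space_distr) simp
  interpret P: pair_prob_space "distr M borel X" "distr M borel Y" ..
  have "(\<integral>\<^sup>+\<omega>. \<psi> (X \<omega>, Y \<omega>) \<partial>M) = (\<integral>\<^sup>+p. \<psi> p \<partial>(distr M borel X \<Otimes>\<^sub>M distr M borel Y))"
    unfolding eq by (simp add: nn_integral_distr)
  also have "\<dots> = (\<integral>\<^sup>+y. \<integral>\<^sup>+x. \<psi> (x, y) \<partial>distr M borel X \<partial>distr M borel Y)"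
    by (subst P.nn_integral_snd[symmetric]) auto
  also have "\<dots> = (\<integral>\<^sup>+\<omega>. \<integral>\<^sup>+\<omega>'. \<psi> (X \<omega>', Y \<omega>) \<partial>M \<partial>M)"
    by (simp add: nn_integral_distr)
  finally show ?thesis .
qed

lemma indep_var_expectation_add:
  assumes ind: "indep_var borel X borel Y" and \<phi>: "bounded_borel \<phi>"
  shows "expectation (\<lambda>\<omega>. \<phi> (X \<omega> + Y \<omega>)) = expectation (\<lambda>\<omega>. expectation (\<lambda>\<omega>'. \<phi> (X \<omega>' + Y \<omega>)))"
proof -
  note [measurable] = bounded_borelD(1)[OF \<phi>]
  obtain C where C: "\<And>x. \<bar>\<phi> x\<bar> \<le> C" using bounded_borelD(2)[OF \<phi>] by auto
  have [measurable]: "X \<in> borel_measurable M" "Y \<in> borel_measurable M"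
    and eq: "distr M borel X \<Otimes>\<^sub>M distr M borel Y = distr M (borel \<Otimes>\<^sub>M borel) (\<lambda>x. (X x, Y x))"
    using ind by (auto simp: indep_var_distribution_eq)
  interpret DX: prob_space "distr M borel X" by (rule prob_space_distr) simp
  interpret DY: prob_space "distr M borel Y" by (rule prob_space_distr) simp
  interpret P: pair_prob_space "distr M borel X" "distr M borel Y" ..
  have "expectation (\<lambda>\<omega>. \<phi> (X \<omega> + Y \<omega>)) = (\<integral>p. \<phi> (fst p + snd p) \<partial>(distr M borel X \<Otimes>\<^sub>M distr M borel Y))"
    unfolding eq by (simp add: integral_distr)
  also have "\<dots> = (\<integral>y. \<integral>x. \<phi> (x + y) \<partial>distr M borel X \<partial>distr M borel Y)"
  proof -
    have "integrable (distr M borel X \<Otimes>\<^sub>M distr M borel Y) (\<lambda>(x, y). \<phi> (x + y))"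
      by (rule P.integrable_bounded[where C = C]) (use C in auto)
    from P.integral_snd[OF this] show ?thesis by (simp add: case_prod_unfold)
  qed
  also have "\<dots> = expectation (\<lambda>\<omega>. expectation (\<lambda>\<omega>'. \<phi> (X \<omega>' + Y \<omega>)))"
    by (simp add: integral_distr)
  finally show ?thesis .
qed

end

locale innovations = prob_space +
  fixes eps :: "int \<Rightarrow> 'a \<Rightarrow> real" and \<sigma> :: real
  assumes eps_indep: "indep_vars (\<lambda>_. borel) eps UNIV"
    and eps_sq_integrable: "\<And>i. integrable M (\<lambda>\<omega>. (eps i \<omega>)\<^sup>2)"
    and eps_sq_le: "\<And>i. expectation (\<lambda>\<omega>. (eps i \<omega>)\<^sup>2) \<le> \<sigma>"
begin

lemma eps_measurable[measurable]: "eps i \<in> borel_measurable M"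
  using eps_indep by (auto simp: indep_vars_def)

lemma \<sigma>_nonneg: "\<sigma> \<ge> 0"
  by (rule order_trans[OF _ eps_sq_le[of 0]]) simp

text \<open>Convolution with the law of a weighted sum of innovations, up to reflection. Composing
  two such operators draws their innovations independently even where the index sets overlap, so
  decoupled expectations are compositions.\<close>

definition avg :: "(int \<Rightarrow> real) \<Rightarrow> int set \<Rightarrow> (real \<Rightarrow> real) \<Rightarrow> real \<Rightarrow> real" where
  "avg c J \<phi> z = expectation (\<lambda>\<omega>. \<phi> (z + (\<Sum>m\<in>J. c m * eps m \<omega>)))"

lemma avg_bounded_borel: "bounded_borel \<phi> \<Longrightarrow> bounded_borel (avg c J \<phi>)"
  unfolding avg_def by (rule bounded_borel_expectation_shift) auto

lemma avg_second_difference_bound: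
  "bounded_borel \<phi> \<Longrightarrow> second_difference_bound B \<phi> \<Longrightarrow> second_difference_bound B (avg c J \<phi>)"
  unfolding avg_def by (rule second_difference_bound_expectation_shift) auto

lemma avg_commute:
  "bounded_borel \<phi> \<Longrightarrow> avg c J (avg d I \<phi>) z = avg d I (avg c J \<phi>) z"
  unfolding avg_def by (rule expectation_shift_commute) auto

lemma avg_integrable:
  assumes \<phi>: "bounded_borel \<phi>"
  shows "integrable M (\<lambda>\<omega>. \<phi> (z + (\<Sum>m\<in>J. c m * eps m \<omega>)))"
proof -
  note [measurable] = bounded_borelD(1)[OF \<phi>]
  obtain C where C: "\<And>x. \<bar>\<phi> x\<bar> \<le> C" using bounded_borelD(2)[OF \<phi>] by auto
  show ?thesis by (rule integrable_bounded[OF _ C]) measurable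
qed

lemma avg_diff:
  assumes "bounded_borel \<phi>" "bounded_borel \<psi>"
  shows "avg c J \<phi> z - avg c J \<psi> z = avg c J (\<lambda>x. \<phi> x - \<psi> x) z"
  unfolding avg_def using avg_integrable assms by simp

lemma avg_abs_le: "(\<And>x. \<bar>\<phi> x\<bar> \<le> C) \<Longrightarrow> \<bar>avg c J \<phi> z\<bar> \<le> C"
  unfolding avg_def by (rule expectation_abs_le)

text \<open>Here genuine independence enters: the innovation at \<open>m\<close> may be drawn
  separately from those in \<open>J\<close>. This factorisation into single-index operators is what
  an induction over \<open>J\<close> needs.\<close>

lemma avg_insert:
  assumes J: "finite J" "m \<notin> J" and \<phi>: "bounded_borel \<phi>"
  shows "avg c (insert m J) \<phi> z = avg c J (avg c {m} \<phi>) z"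
proof -
  have "indep_vars (\<lambda>_. borel) (\<lambda>i \<omega>. c i * eps i \<omega>) (insert m J)"
    by (rule indep_vars_compose2[OF indep_vars_subset[OF eps_indep subset_UNIV]]) simp
  from indep_vars_sum[OF J this]
  have ind: "indep_var borel (\<lambda>\<omega>. c m * eps m \<omega>) borel (\<lambda>\<omega>. \<Sum>i\<in>J. c i * eps i \<omega>)" .
  have "bounded_borel (\<lambda>x. \<phi> (z + x))"
    using \<phi> unfolding bounded_borel_def by auto
  from indep_var_expectation_add[OF ind this] J show ?thesis
    by (simp add: avg_def ac_simps)
qed

text \<open>Let x be the innovation and y its copy. The difference \<phi> (z + v x - b x) - \<phi>
  (z + v x - b y) has the same form with v = 0 as a counterpart, and that counterpart has mean zero
  since x and y share their law. Subtracting it leaves a mixed second difference, which carries a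
  factor |v| as well as |b|.\<close>

lemma avg_singleton_swap:
  assumes \<phi>: "bounded_borel \<phi>" and sd: "second_difference_bound B \<phi>" and B: "B \<ge> 0"
  shows "\<bar>avg (\<lambda>i. v i - b i) {m} \<phi> z - avg v {m} (avg (\<lambda>i. - b i) {m} \<phi>) z\<bar>
         \<le> 2 * B * \<sigma> * (\<bar>v m\<bar> * \<bar>b m\<bar>)"
proof -
  note [measurable] = bounded_borelD(1)[OF \<phi>]
  obtain C where C: "\<And>x. \<bar>\<phi> x\<bar> \<le> C" using bounded_borelD(2)[OF \<phi>] by auto
  define I where "I = avg (\<lambda>i. - b i) {m} \<phi>"
  have I: "bounded_borel I" unfolding I_def by (rule avg_bounded_borel[OF \<phi>])
  define V where "V = B * \<bar>v m\<bar> * \<bar>b m\<bar>"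
  have V: "V \<ge> 0" using B by (simp add: V_def)
  have phi_i: "integrable M (\<lambda>\<omega>'. \<phi> (y - b m * eps m \<omega>'))" for y
    by (rule integrable_bounded[OF _ C]) measurable
  have inner: "\<bar>\<phi> (z + v m * x - b m * x) - I (z + v m * x) - \<phi> (z - b m * x) + I z\<bar>
      \<le> V * (3/2 * x\<^sup>2 + \<sigma> / 2)" for x
  proof -
    let ?q = "\<lambda>\<omega>'. \<phi> (z + v m * x - b m * x) - \<phi> (z + v m * x - b m * eps m \<omega>')
                 - \<phi> (z - b m * x) + \<phi> (z - b m * eps m \<omega>')"
    have q: "\<bar>?q \<omega>'\<bar> \<le> V * (3/2 * x\<^sup>2 + (eps m \<omega>')\<^sup>2 / 2)" for \<omega>'
    proof -
      let ?y = "eps m \<omega>'"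
      \<comment> \<open>The base point is z - b y, with increments s = v x and t = b (y - x); the
        four corners are exactly the terms of \<open>?q\<close>.\<close>
      have "\<bar>?q \<omega>'\<bar> \<le> B * \<bar>v m * x\<bar> * \<bar>b m * (?y - x)\<bar>"
        using sd[unfolded second_difference_bound_def, rule_format, of "z - b m * ?y" "v m * x" "b m * (?y - x)"]
        by (simp add: algebra_simps)
      also have "\<dots> = V * (\<bar>x\<bar> * \<bar>?y - x\<bar>)"
        by (simp add: V_def abs_mult)
      \<comment> \<open>The product is replaced by squares so that second moments suffice; averaging
        over x and y later bounds this by 2 \<sigma>.\<close>
      also have "\<bar>x\<bar> * \<bar>?y - x\<bar> \<le> 3/2 * x\<^sup>2 + ?y\<^sup>2 / 2"
      proof -
        have "\<bar>x\<bar> * \<bar>?y - x\<bar> \<le> \<bar>x\<bar> * (\<bar>?y\<bar> + \<bar>x\<bar>)" by (intro mult_left_mono) auto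
        also have "\<dots> = \<bar>x\<bar> * \<bar>?y\<bar> + x\<^sup>2" by (simp add: distrib_left power2_eq_square)
        also have "\<bar>x\<bar> * \<bar>?y\<bar> \<le> (x\<^sup>2 + ?y\<^sup>2) / 2"
          using sum_squares_bound[of "\<bar>x\<bar>" "\<bar>?y\<bar>"] by simp
        finally show ?thesis by (simp add: field_simps)
      qed
      finally show ?thesis using V by (simp add: mult_left_mono)
    qed
    have "expectation ?q = \<phi> (z + v m * x - b m * x) - I (z + v m * x) - \<phi> (z - b m * x) + I z"
      using phi_i by (simp add: I_def avg_def prob_space)
    moreover have "\<bar>expectation ?q\<bar> \<le> expectation (\<lambda>\<omega>'. \<bar>?q \<omega>'\<bar>)" by (rule integral_abs_bound)
    moreover have "\<dots> \<le> expectation (\<lambda>\<omega>'. V * (3/2 * x\<^sup>2 + (eps m \<omega>')\<^sup>2 / 2))"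
      using phi_i eps_sq_integrable by (intro integral_mono q) auto
    moreover have "\<dots> = V * (3/2 * x\<^sup>2 + expectation (\<lambda>\<omega>'. (eps m \<omega>')\<^sup>2) / 2)"
      using eps_sq_integrable by (simp add: prob_space)
    moreover have "\<dots> \<le> V * (3/2 * x\<^sup>2 + \<sigma> / 2)"
      using eps_sq_le[of m] V by (intro mult_left_mono) auto
    ultimately show ?thesis by linarith
  qed
  let ?e = "eps m"
  have i1: "integrable M (\<lambda>\<omega>. \<phi> (z + v m * ?e \<omega> - b m * ?e \<omega>))"
    by (rule integrable_bounded[OF _ C]) measurable
  have i2: "integrable M (\<lambda>\<omega>. I (z + v m * ?e \<omega>))"
    using avg_integrable[OF I, of z v "{m}"] by simp
  \<comment> \<open>The last two terms complete the mixed difference and cancel in the mean, because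
    \<open>I z\<close> is the expectation of \<phi> (z - b x).\<close>
  define T where "T \<omega> = \<phi> (z + v m * ?e \<omega> - b m * ?e \<omega>) - I (z + v m * ?e \<omega>) - \<phi> (z - b m * ?e \<omega>) + I z" for \<omega>
  have T_int: "integrable M T"
    unfolding T_def using i1 i2 phi_i by simp
  have T_eq: "avg (\<lambda>i. v i - b i) {m} \<phi> z - avg v {m} I z = expectation T"
    unfolding T_def using i1 i2 phi_i by (simp add: avg_def I_def left_diff_distrib prob_space add_diff_eq)
  have "\<bar>expectation T\<bar> \<le> expectation (\<lambda>\<omega>. \<bar>T \<omega>\<bar>)"
    by (rule integral_abs_bound)
  also have "\<dots> \<le> expectation (\<lambda>\<omega>. V * (3/2 * (?e \<omega>)\<^sup>2 + \<sigma> / 2))"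
  proof (rule integral_mono)
    show "integrable M (\<lambda>\<omega>. \<bar>T \<omega>\<bar>)" using T_int by (rule integrable_abs)
    show "integrable M (\<lambda>\<omega>. V * (3/2 * (?e \<omega>)\<^sup>2 + \<sigma> / 2))" using eps_sq_integrable by auto
  qed (simp only: T_def inner)
  also have "\<dots> = V * (3/2 * expectation (\<lambda>\<omega>. (?e \<omega>)\<^sup>2) + \<sigma> / 2)"
    using eps_sq_integrable by (simp add: prob_space)
  also have "\<dots> \<le> V * (3/2 * \<sigma> + \<sigma> / 2)"
    using eps_sq_le[of m] V by (intro mult_left_mono) auto
  finally show ?thesis unfolding T_eq[symmetric] by (simp add: V_def I_def algebra_simps)
qed

text \<open>
  Lindeberg's replacement: \<open>\<Sum> v\<^sub>m \<epsilon>\<^sub>m - \<Sum> b\<^sub>m \<epsilon>\<^sub>m\<close> is turned into \<open>\<Sum> v\<^sub>m \<epsilon>\<^sub>m - \<Sum> b\<^sub>m \<epsilon>'\<^sub>m\<close>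
  with an independent copy \<open>\<epsilon>'\<close>, one index at a time. Each step costs a mixed second difference,
  which makes the error bilinear in the two coefficient sequences; that is what makes it
  summable over all lags when only \<open>\<Sum> |a\<^sub>i| < \<infinity>\<close> is known.
\<close>

lemma avg_decoupling:
  assumes J: "finite J" and B: "B \<ge> 0"
    and \<phi>: "bounded_borel \<phi>" and sd: "second_difference_bound B \<phi>"
  shows "\<bar>avg (\<lambda>i. v i - b i) J \<phi> z - avg v J (avg (\<lambda>i. - b i) J \<phi>) z\<bar>
         \<le> 2 * B * \<sigma> * (\<Sum>m\<in>J. \<bar>v m\<bar> * \<bar>b m\<bar>)"
  using J \<phi> sd
proof (induction J arbitrary: \<phi> z rule: finite_induct)
  case empty
  then show ?case by (simp add: avg_def prob_space)
next
  case (insert m J)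
  define c where "c = (\<lambda>i. v i - b i)"
  define d where "d = (\<lambda>i. - b i)"
  note \<phi> = insert.prems(1) and sd = insert.prems(2)
  \<comment> \<open>\<open>\<psi>1\<close> keeps the shared innovation at \<open>m\<close>, while
    \<open>\<psi>2\<close> has it decoupled. The induction hypothesis applies to
    \<open>\<psi>1\<close>, which inherits the second difference bound. \<open>\<psi>2\<close>
    enters only through the sup distance from \<open>\<psi>1\<close>, and averaging does not
    increase that.\<close>
  define \<psi>1 where "\<psi>1 = avg c {m} \<phi>"
  define \<psi>2 where "\<psi>2 = avg v {m} (avg d {m} \<phi>)"
  have b1: "bounded_borel \<psi>1" "second_difference_bound B \<psi>1"
    and b2: "bounded_borel \<psi>2" and bd: "bounded_borel (avg d {m} \<phi>)" "bounded_borel (avg d J \<psi>1)" "bounded_borel (avg d J \<psi>2)"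
      "bounded_borel (avg d J (avg d {m} \<phi>))"
    unfolding \<psi>1_def \<psi>2_def using \<phi> sd
    by (auto intro!: avg_bounded_borel avg_second_difference_bound)
  have "avg c (insert m J) \<phi> z = avg c J \<psi>1 z"
    unfolding \<psi>1_def using insert \<phi> by (intro avg_insert) auto
  moreover have "avg v (insert m J) (avg d (insert m J) \<phi>) z = avg v J (avg d J \<psi>2) z"
  proof -
    have "avg d (insert m J) \<phi> = avg d J (avg d {m} \<phi>)"
      using insert \<phi> by (intro ext avg_insert) auto
    then have "avg v (insert m J) (avg d (insert m J) \<phi>) z = avg v J (avg v {m} (avg d J (avg d {m} \<phi>))) z"
      using insert bd by (simp add: avg_insert)
    \<comment> \<open>Commuting brings the two averages at index \<open>m\<close> together, so that
      they form \<open>\<psi>2\<close>.\<close>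
    also have "avg v {m} (avg d J (avg d {m} \<phi>)) = avg d J \<psi>2"
      unfolding \<psi>2_def using bd by (intro ext avg_commute)
    finally show ?thesis .
  qed
  moreover have "\<bar>avg c J \<psi>1 z - avg v J (avg d J \<psi>1) z\<bar> \<le> 2 * B * \<sigma> * (\<Sum>m\<in>J. \<bar>v m\<bar> * \<bar>b m\<bar>)"
    unfolding c_def d_def by (rule insert.IH[OF b1])
  moreover have "\<bar>avg v J (avg d J \<psi>1) z - avg v J (avg d J \<psi>2) z\<bar> \<le> 2 * B * \<sigma> * (\<bar>v m\<bar> * \<bar>b m\<bar>)"
  proof -
    have "\<bar>\<psi>1 x - \<psi>2 x\<bar> \<le> 2 * B * \<sigma> * (\<bar>v m\<bar> * \<bar>b m\<bar>)" for x
      unfolding \<psi>1_def \<psi>2_def c_def d_def by (rule avg_singleton_swap[OF \<phi> sd B])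
    then show ?thesis
      using b1 b2 bd by (simp add: avg_diff avg_abs_le)
  qed
  ultimately have "\<bar>avg c (insert m J) \<phi> z - avg v (insert m J) (avg d (insert m J) \<phi>) z\<bar>
      \<le> 2 * B * \<sigma> * (\<Sum>m\<in>J. \<bar>v m\<bar> * \<bar>b m\<bar>) + 2 * B * \<sigma> * (\<bar>v m\<bar> * \<bar>b m\<bar>)"
    by linarith
  also have "\<dots> = 2 * B * \<sigma> * (\<Sum>m\<in>insert m J. \<bar>v m\<bar> * \<bar>b m\<bar>)"
    using insert by (simp add: algebra_simps)
  finally show ?case by (simp add: c_def d_def)
qed

end

section \<open>Kernel autocorrelation\<close>

definition autocorr :: "(real \<Rightarrow> real) \<Rightarrow> real \<Rightarrow> real" where
  "autocorr \<kappa> y = (\<integral>x. \<kappa> x * \<kappa> (x + y) \<partial>lborel)"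

text \<open>Meant for K (x / h) / h, where \<open>L1\<close> does not depend on h but
  \<open>B\<close> is of order 1/h. The estimates below keep track of which of the two they
  use.\<close>

locale bounded_kernel =
  fixes \<kappa> :: "real \<Rightarrow> real" and B :: real
  assumes \<kappa>_int: "integrable lborel \<kappa>"
    and \<kappa>_cont: "\<And>x. isCont \<kappa> x"
    and \<kappa>_le: "\<And>x. \<bar>\<kappa> x\<bar> \<le> B"
begin

abbreviation "L1 \<equiv> (\<integral>x. \<bar>\<kappa> x\<bar> \<partial>lborel)"

lemma B_nonneg: "B \<ge> 0"
  using \<kappa>_le[of 0] by linarith

lemma \<kappa>_measurable[measurable]: "\<kappa> \<in> borel_measurable borel"
  using \<kappa>_int by auto

lemma autocorr_integrable_inner: "integrable lborel (\<lambda>x. \<kappa> x * \<kappa> (x + y))"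
  by (rule integrable_mult_bounded[OF \<kappa>_int _ \<kappa>_le]) measurable

lemma autocorr_le: "\<bar>autocorr \<kappa> y\<bar> \<le> B * L1"
proof -
  have "\<bar>autocorr \<kappa> y\<bar> \<le> (\<integral>x. \<bar>\<kappa> x * \<kappa> (x + y)\<bar> \<partial>lborel)"
    unfolding autocorr_def by (rule integral_abs_bound)
  also have "\<dots> \<le> (\<integral>x. B * \<bar>\<kappa> x\<bar> \<partial>lborel)"
  proof (rule integral_mono)
    show "integrable lborel (\<lambda>x. \<bar>\<kappa> x * \<kappa> (x + y)\<bar>)"
      using autocorr_integrable_inner by (rule integrable_abs)
    show "integrable lborel (\<lambda>x. B * \<bar>\<kappa> x\<bar>)"
      using \<kappa>_int by auto
    show "\<bar>\<kappa> x * \<kappa> (x + y)\<bar> \<le> B * \<bar>\<kappa> x\<bar>" for x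
      using mult_right_mono[OF \<kappa>_le[of "x + y"], of "\<bar>\<kappa> x\<bar>"] by (simp add: abs_mult mult.commute)
  qed
  finally show ?thesis by simp
qed

text \<open>Dominated convergence transfers continuity from the kernel. It is used to pass from
  truncated linear processes to the full ones.\<close>

lemma autocorr_isCont: "isCont (autocorr \<kappa>) y"
proof (rule continuous_at_sequentiallyI)
  fix u :: "nat \<Rightarrow> real" assume u: "u \<longlonglongrightarrow> y"
  show "(\<lambda>n. autocorr \<kappa> (u n)) \<longlonglongrightarrow> autocorr \<kappa> y"
    unfolding autocorr_def
  proof (rule integral_dominated_convergence[where w = "\<lambda>x. B * \<bar>\<kappa> x\<bar>"])
    show "integrable lborel (\<lambda>x. B * \<bar>\<kappa> x\<bar>)" using \<kappa>_int by auto
    show "AE x in lborel. (\<lambda>n. \<kappa> x * \<kappa> (x + u n)) \<longlonglongrightarrow> \<kappa> x * \<kappa> (x + y)"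
      by (intro AE_I2 tendsto_intros isCont_tendsto_compose[OF \<kappa>_cont] u)
    show "AE x in lborel. norm (\<kappa> x * \<kappa> (x + u n)) \<le> B * \<bar>\<kappa> x\<bar>" for n
    proof (rule AE_I2)
      fix x show "norm (\<kappa> x * \<kappa> (x + u n)) \<le> B * \<bar>\<kappa> x\<bar>"
        using mult_right_mono[OF \<kappa>_le[of "x + u n"], of "\<bar>\<kappa> x\<bar>"] by (simp add: abs_mult mult.commute)
    qed
  qed measurable
qed

lemma autocorr_measurable[measurable]: "autocorr \<kappa> \<in> borel_measurable borel"
  unfolding autocorr_def by measurable

lemma autocorr_bounded_borel: "bounded_borel (autocorr \<kappa>)"
  unfolding bounded_borel_def using autocorr_le by auto

text \<open>Young's inequality for an L1 convolution, by Tonelli and translation invariance. This is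
  the norm of the autocorrelation that stays bounded as h tends to 0.\<close>

lemma autocorr_L1:
  shows "integrable lborel (autocorr \<kappa>)" "(\<integral>y. \<bar>autocorr \<kappa> y\<bar> \<partial>lborel) \<le> L1\<^sup>2"
proof -
  have L1: "(\<integral>\<^sup>+x. ennreal \<bar>\<kappa> x\<bar> \<partial>lborel) = ennreal L1"
    using \<kappa>_int by (intro nn_integral_eq_integral) auto
  have "(\<integral>\<^sup>+y. ennreal \<bar>autocorr \<kappa> y\<bar> \<partial>lborel)
      \<le> (\<integral>\<^sup>+y. \<integral>\<^sup>+x. ennreal \<bar>\<kappa> x\<bar> * ennreal \<bar>\<kappa> (x + y)\<bar> \<partial>lborel \<partial>lborel)"
  proof (rule nn_integral_mono)
    fix y
    have "ennreal (norm (autocorr \<kappa> y)) \<le> (\<integral>\<^sup>+x. ennreal (norm (\<kappa> x * \<kappa> (x + y))) \<partial>lborel)"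
      unfolding autocorr_def using autocorr_integrable_inner by (rule integral_norm_bound_ennreal)
    then show "ennreal \<bar>autocorr \<kappa> y\<bar> \<le> (\<integral>\<^sup>+x. ennreal \<bar>\<kappa> x\<bar> * ennreal \<bar>\<kappa> (x + y)\<bar> \<partial>lborel)"
      by (simp add: abs_mult ennreal_mult)
  qed
  also have "\<dots> = (\<integral>\<^sup>+x. \<integral>\<^sup>+y. ennreal \<bar>\<kappa> x\<bar> * ennreal \<bar>\<kappa> (x + y)\<bar> \<partial>lborel \<partial>lborel)"
    by (rule lborel_pair.Fubini'[symmetric], measurable)
  also have "\<dots> = (\<integral>\<^sup>+x. ennreal \<bar>\<kappa> x\<bar> * ennreal L1 \<partial>lborel)"
  proof (rule nn_integral_cong)
    fix x
    have "(\<integral>\<^sup>+y. ennreal \<bar>\<kappa> (x + y)\<bar> \<partial>lborel) = ennreal L1"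
      using nn_integral_real_affine[of "\<lambda>y. ennreal \<bar>\<kappa> y\<bar>" 1 x] L1 by simp
    then show "(\<integral>\<^sup>+y. ennreal \<bar>\<kappa> x\<bar> * ennreal \<bar>\<kappa> (x + y)\<bar> \<partial>lborel) = ennreal \<bar>\<kappa> x\<bar> * ennreal L1"
      by (simp add: nn_integral_cmult)
  qed
  also have "\<dots> = ennreal L1 * ennreal L1"
    using L1 by (simp add: nn_integral_multc)
  finally have le: "(\<integral>\<^sup>+y. ennreal \<bar>autocorr \<kappa> y\<bar> \<partial>lborel) \<le> ennreal (L1\<^sup>2)"
    by (simp add: ennreal_mult power2_eq_square)
  show i: "integrable lborel (autocorr \<kappa>)"
    by (rule integrableI_bounded) (use le in \<open>auto simp: less_top[symmetric] top_unique\<close>)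
  then have "(\<integral>\<^sup>+y. ennreal \<bar>autocorr \<kappa> y\<bar> \<partial>lborel) = ennreal (\<integral>y. \<bar>autocorr \<kappa> y\<bar> \<partial>lborel)"
    by (intro nn_integral_eq_integral) auto
  with le show "(\<integral>y. \<bar>autocorr \<kappa> y\<bar> \<partial>lborel) \<le> L1\<^sup>2"
    by (simp add: ennreal_le_iff)
qed

lemma translate_product_integral:
  "integrable lborel (\<lambda>x. \<kappa> (x - z) * \<kappa> (x - z'))"
  "(\<integral>x. \<kappa> (x - z) * \<kappa> (x - z') \<partial>lborel) = autocorr \<kappa> (z - z')"
  "(\<integral>x. \<bar>\<kappa> (x - z) * \<kappa> (x - z')\<bar> \<partial>lborel) \<le> B * L1"
proof -
  have i1: "integrable lborel (\<lambda>x. \<kappa> (x - z))"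
    using lborel_integrable_real_affine[OF \<kappa>_int, of 1 "-z"] by simp
  show i: "integrable lborel (\<lambda>x. \<kappa> (x - z) * \<kappa> (x - z'))"
    by (rule integrable_mult_bounded[OF i1 _ \<kappa>_le]) measurable
  show "(\<integral>x. \<kappa> (x - z) * \<kappa> (x - z') \<partial>lborel) = autocorr \<kappa> (z - z')"
    using lborel_integral_real_affine[of 1 "\<lambda>x. \<kappa> (x - z) * \<kappa> (x - z')" z]
    by (simp add: autocorr_def algebra_simps)
  have "(\<integral>x. \<bar>\<kappa> (x - z) * \<kappa> (x - z')\<bar> \<partial>lborel) \<le> (\<integral>x. B * \<bar>\<kappa> (x - z)\<bar> \<partial>lborel)"
  proof (rule integral_mono)
    show "integrable lborel (\<lambda>x. \<bar>\<kappa> (x - z) * \<kappa> (x - z')\<bar>)" using i by (rule integrable_abs)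
    show "integrable lborel (\<lambda>x. B * \<bar>\<kappa> (x - z)\<bar>)" using i1 by auto
    show "\<bar>\<kappa> (x - z) * \<kappa> (x - z')\<bar> \<le> B * \<bar>\<kappa> (x - z)\<bar>" for x
      using mult_right_mono[OF \<kappa>_le[of "x - z'"], of "\<bar>\<kappa> (x - z)\<bar>"] by (simp add: abs_mult mult.commute)
  qed
  also have "\<dots> = B * L1"
    using lborel_integral_real_affine[of 1 "\<lambda>x. \<bar>\<kappa> x\<bar>" "-z"] by simp
  finally show "(\<integral>x. \<bar>\<kappa> (x - z) * \<kappa> (x - z')\<bar> \<partial>lborel) \<le> B * L1" .
qed

text \<open>Integrating over x first turns products of kernel terms into the autocorrelation. The
  space \<open>N\<close> is arbitrary because the lemma is applied both to \<open>M\<close>, for the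
  joint law of two observations, and to its square, for independent copies.\<close>

lemma expectation_product_integral:
  assumes N: "prob_space N" and [measurable]: "Z \<in> borel_measurable N" "Z' \<in> borel_measurable N"
  shows "integrable lborel (\<lambda>x. \<integral>\<omega>. \<kappa> (x - Z \<omega>) * \<kappa> (x - Z' \<omega>) \<partial>N)"
    and "(\<integral>x. (\<integral>\<omega>. \<kappa> (x - Z \<omega>) * \<kappa> (x - Z' \<omega>) \<partial>N) \<partial>lborel) = (\<integral>\<omega>. autocorr \<kappa> (Z \<omega> - Z' \<omega>) \<partial>N)"
proof -
  interpret N: prob_space N by (rule N)
  interpret P: pair_sigma_finite N "lborel :: real measure" ..
  have i: "integrable (N \<Otimes>\<^sub>M lborel) (\<lambda>(\<omega>, x). \<kappa> (x - Z \<omega>) * \<kappa> (x - Z' \<omega>))"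
  proof (rule P.Fubini_integrable)
    have "integrable N (\<lambda>\<omega>. (\<integral>x. \<bar>\<kappa> (x - Z \<omega>) * \<kappa> (x - Z' \<omega>)\<bar> \<partial>lborel))"
    proof (rule N.integrable_bounded[where C = "B * L1"])
      show "\<bar>\<integral>x. \<bar>\<kappa> (x - Z \<omega>) * \<kappa> (x - Z' \<omega>)\<bar> \<partial>lborel\<bar> \<le> B * L1" for \<omega>
        using translate_product_integral(3) by simp
    qed measurable
    then show "integrable N (\<lambda>\<omega>. \<integral>x. norm (case (\<omega>, x) of (\<omega>, x) \<Rightarrow> \<kappa> (x - Z \<omega>) * \<kappa> (x - Z' \<omega>)) \<partial>lborel)"
      by simp
    show "AE \<omega> in N. integrable lborel (\<lambda>x. case (\<omega>, x) of (\<omega>, x) \<Rightarrow> \<kappa> (x - Z \<omega>) * \<kappa> (x - Z' \<omega>))"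
      using translate_product_integral(1) by simp
  qed measurable
  show "integrable lborel (\<lambda>x. \<integral>\<omega>. \<kappa> (x - Z \<omega>) * \<kappa> (x - Z' \<omega>) \<partial>N)"
    using P.integrable_snd[OF i] .
  show "(\<integral>x. (\<integral>\<omega>. \<kappa> (x - Z \<omega>) * \<kappa> (x - Z' \<omega>) \<partial>N) \<partial>lborel) = (\<integral>\<omega>. autocorr \<kappa> (Z \<omega> - Z' \<omega>) \<partial>N)"
    using P.Fubini_integral[OF i] by (simp add: translate_product_integral(2))
qed

end

text \<open>All differences fall on \<open>g\<close>, so no regularity of \<open>W\<close> is used
  and only its L1 norm enters the constant.\<close>

lemma second_difference_bound_smoothing:
  fixes W g :: "real \<Rightarrow> real"
  assumes W: "integrable lborel W" and g: "bounded_borel g" "second_difference_bound C g"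
  shows "second_difference_bound (C * (\<integral>y. \<bar>W y\<bar> \<partial>lborel)) (\<lambda>z. \<integral>y. W y * g (y - z) \<partial>lborel)"
  unfolding second_difference_bound_def
proof (intro allI)
  fix z s t
  note [measurable] = bounded_borelD(1)[OF g(1)]
  obtain D where D: "\<And>x. \<bar>g x\<bar> \<le> D" using bounded_borelD(2)[OF g(1)] by auto
  have i: "integrable lborel (\<lambda>y. W y * g (y - x))" for x
    by (rule integrable_mult_bounded[OF W _ D]) measurable
  define T where "T y = W y * g (y - (z + s + t)) - W y * g (y - (z + s)) - W y * g (y - (z + t)) + W y * g (y - z)" for y
  have T_int: "integrable lborel T"
    unfolding T_def using i by simp
  have T_le: "\<bar>T y\<bar> \<le> C * \<bar>s\<bar> * \<bar>t\<bar> * \<bar>W y\<bar>" for y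
  proof -
    have "T y = W y * (g (y - z + - s + - t) - g (y - z + - s) - g (y - z + - t) + g (y - z))"
      by (simp add: T_def algebra_simps)
    moreover have "\<bar>g (y - z + - s + - t) - g (y - z + - s) - g (y - z + - t) + g (y - z)\<bar> \<le> C * \<bar>s\<bar> * \<bar>t\<bar>"
      using g(2)[unfolded second_difference_bound_def, rule_format, of "y - z" "-s" "-t"] by simp
    ultimately show ?thesis
      by (simp add: abs_mult mult.commute mult_left_mono)
  qed
  have "\<bar>\<integral>y. T y \<partial>lborel\<bar> \<le> (\<integral>y. \<bar>T y\<bar> \<partial>lborel)"
    by (rule integral_abs_bound)
  also have "\<dots> \<le> (\<integral>y. C * \<bar>s\<bar> * \<bar>t\<bar> * \<bar>W y\<bar> \<partial>lborel)"
  proof (rule integral_mono)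
    show "integrable lborel (\<lambda>y. \<bar>T y\<bar>)" using T_int by (rule integrable_abs)
    show "integrable lborel (\<lambda>y. C * \<bar>s\<bar> * \<bar>t\<bar> * \<bar>W y\<bar>)" using W by auto
  qed (rule T_le)
  also have "\<dots> = C * (\<integral>y. \<bar>W y\<bar> \<partial>lborel) * \<bar>s\<bar> * \<bar>t\<bar>" by simp
  finally show "\<bar>(\<integral>y. W y * g (y - (z + s + t)) \<partial>lborel) - (\<integral>y. W y * g (y - (z + s)) \<partial>lborel)
      - (\<integral>y. W y * g (y - (z + t)) \<partial>lborel) + (\<integral>y. W y * g (y - z) \<partial>lborel)\<bar>
      \<le> C * (\<integral>y. \<bar>W y\<bar> \<partial>lborel) * \<bar>s\<bar> * \<bar>t\<bar>"
    unfolding T_def using i by simp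
qed

section \<open>Linear processes\<close>

lemma has_real_derivative_rescale:
  fixes u u' :: "real \<Rightarrow> real"
  assumes "\<And>x. (u has_real_derivative u' x) (at x)"
  shows "((\<lambda>w. u (w / c) / d) has_real_derivative u' (w / c) / (c * d)) (at w)"
proof -
  have "((\<lambda>w. u (w / c)) has_real_derivative u' (w / c) * (1 / c)) (at w)"
    by (rule DERIV_chain'[where f = "\<lambda>w. w / c" and g = u, OF DERIV_cdivide[OF DERIV_ident] assms])
  then show ?thesis
    using DERIV_cdivide[of "\<lambda>w. u (w / c)" "u' (w / c) * (1 / c)" w UNIV d] by simp
qed

locale linear_process = innovations +
  fixes fe fe1 fe2 f :: "real \<Rightarrow> real" and a :: "nat \<Rightarrow> real" and k :: nat and F0 F2 :: real
  assumes eps_dens: "\<And>i. distributed M lborel (eps i) (\<lambda>x. ennreal (fe x))"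
    and fe_nonneg: "\<And>x. fe x \<ge> 0"
    and fe_deriv1: "\<And>x. (fe has_real_derivative fe1 x) (at x)"
    and fe_deriv2: "\<And>x. (fe1 has_real_derivative fe2 x) (at x)"
    and fe_le: "\<And>x. fe x \<le> F0"
    and fe2_le: "\<And>x. \<bar>fe2 x\<bar> \<le> F2"
    and fe2_L2: "integrable lborel (\<lambda>x. (fe2 x)\<^sup>2)"
    and a_abs: "summable (\<lambda>i. \<bar>a i\<bar>)"
    and a_k: "a k \<noteq> 0" and a_below_k: "\<And>l. l < k \<Longrightarrow> a l = 0"
    and f_nonneg: "\<And>x. f x \<ge> 0"
    and X_dens: "\<And>n. distributed M lborel (linproc a eps n) (\<lambda>x. ennreal (f x))"
begin

abbreviation "X \<equiv> linproc a eps"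

definition g :: "real \<Rightarrow> real" where "g w = fe (w / a k) / \<bar>a k\<bar>"

definition g1 :: "real \<Rightarrow> real" where "g1 w = fe1 (w / a k) / (a k * \<bar>a k\<bar>)"

definition g2 :: "real \<Rightarrow> real" where "g2 w = fe2 (w / a k) / (a k * (a k * \<bar>a k\<bar>))"

lemma g_deriv1: "(g has_real_derivative g1 x) (at x)"
  unfolding g_def[abs_def] g1_def by (rule has_real_derivative_rescale[OF fe_deriv1])

lemma g_deriv2: "(g1 has_real_derivative g2 x) (at x)"
  unfolding g1_def[abs_def] g2_def by (rule has_real_derivative_rescale[OF fe_deriv2])

lemma fe_measurable[measurable]: "fe \<in> borel_measurable borel"
  using continuous_on_of_real_derivative[OF fe_deriv1] by (rule borel_measurable_continuous_onI)

lemma g_measurable[measurable]: "g \<in> borel_measurable borel"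
  using continuous_on_of_real_derivative[OF g_deriv1] by (rule borel_measurable_continuous_onI)

lemma g_nonneg: "g x \<ge> 0"
  using fe_nonneg by (simp add: g_def)

lemma g_le: "g x \<le> F0 / \<bar>a k\<bar>"
  using fe_le by (simp add: g_def divide_right_mono)

lemma g_abs_le: "\<bar>g x\<bar> \<le> F0 / \<bar>a k\<bar>"
  using g_le g_nonneg by simp

lemma g2_le: "\<bar>g2 x\<bar> \<le> F2 / \<bar>a k\<bar> ^ 3"
proof -
  have "\<bar>a k * (a k * \<bar>a k\<bar>)\<bar> = \<bar>a k\<bar> ^ 3" by (simp add: abs_mult power3_eq_cube)
  then show ?thesis using fe2_le by (simp add: g2_def divide_right_mono)
qed

lemma g2_L2: "integrable lborel (\<lambda>x. (g2 x)\<^sup>2)"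
proof -
  have "integrable lborel (\<lambda>x. (fe2 (0 + (1 / a k) * x))\<^sup>2 / (a k * (a k * \<bar>a k\<bar>))\<^sup>2)"
    using lborel_integrable_real_affine[OF fe2_L2, of "1 / a k" 0] a_k by simp
  then show ?thesis by (simp add: g2_def power_divide)
qed

lemma g_bounded_borel: "bounded_borel g"
  unfolding bounded_borel_def using g_abs_le by auto

lemma F2_nonneg: "F2 \<ge> 0"
  using fe2_le[of 0] by linarith

lemma X_measurable[measurable]: "X n \<in> borel_measurable M"
  using distributed_measurable[OF X_dens] by simp

lemma expectation_eps_rescale:
  assumes \<phi>: "\<phi> \<in> borel_measurable borel"
  shows "expectation (\<lambda>\<omega>. \<phi> (z + a k * eps m \<omega>)) = (\<integral>y. \<phi> y * g (y - z) \<partial>lborel)"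
proof -
  note [measurable] = \<phi>
  have "expectation (\<lambda>\<omega>. \<phi> (z + a k * eps m \<omega>)) = (\<integral>x. fe x * \<phi> (z + a k * x) \<partial>lborel)"
    by (rule distributed_integral[OF eps_dens, symmetric]) (use fe_nonneg in auto)
  also have "\<dots> = (\<integral>y. \<phi> y * g (y - z) \<partial>lborel)"
    using lborel_integral_real_affine[of "a k" "\<lambda>y. \<phi> y * g (y - z)" z] a_k
    by (simp add: g_def mult.commute)
  finally show ?thesis .
qed

lemma nn_integral_eps_rescale:
  assumes \<phi>: "\<phi> \<in> borel_measurable borel"
  shows "(\<integral>\<^sup>+\<omega>. \<phi> (z + a k * eps m \<omega>) \<partial>M) = (\<integral>\<^sup>+y. \<phi> y * ennreal (g (y - z)) \<partial>lborel)"
proof -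
  note [measurable] = \<phi>
  have "(\<integral>\<^sup>+\<omega>. \<phi> (z + a k * eps m \<omega>) \<partial>M) = (\<integral>\<^sup>+x. ennreal (fe x) * \<phi> (z + a k * x) \<partial>lborel)"
    by (rule distributed_nn_integral[OF eps_dens, symmetric]) auto
  also have "\<dots> = (\<integral>\<^sup>+x. ennreal \<bar>a k\<bar> * (\<phi> (z + a k * x) * ennreal (g (a k * x))) \<partial>lborel)"
  proof (rule nn_integral_cong)
    fix x
    have "ennreal (fe x) = ennreal \<bar>a k\<bar> * ennreal (g (a k * x))"
      using a_k g_nonneg by (simp add: g_def ennreal_mult[symmetric] fe_nonneg)
    then show "ennreal (fe x) * \<phi> (z + a k * x) = ennreal \<bar>a k\<bar> * (\<phi> (z + a k * x) * ennreal (g (a k * x)))"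
      by (simp add: ac_simps)
  qed
  also have "\<dots> = ennreal \<bar>a k\<bar> * (\<integral>\<^sup>+x. \<phi> (z + a k * x) * ennreal (g (a k * x)) \<partial>lborel)"
    by (rule nn_integral_cmult) measurable
  also have "\<dots> = (\<integral>\<^sup>+y. \<phi> y * ennreal (g (y - z)) \<partial>lborel)"
    using nn_integral_real_affine[of "\<lambda>y. \<phi> y * ennreal (g (y - z))" "a k" z] a_k
    by simp
  finally show ?thesis .
qed

text \<open>Averaging over an innovation with weight \<open>a k\<close> integrates \<open>W\<close>
  against translates of \<open>g\<close>, and F2 / |a k|^3 bounds \<open>g2\<close>.\<close>

lemma avg_smoothing:
  assumes W: "integrable lborel W" "bounded_borel W" and c: "c m = a k"
  shows "second_difference_bound (F2 / \<bar>a k\<bar> ^ 3 * (\<integral>y. \<bar>W y\<bar> \<partial>lborel)) (avg c {m} W)"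
proof -
  have "avg c {m} W = (\<lambda>z. \<integral>y. W y * g (y - z) \<partial>lborel)"
    unfolding avg_def using expectation_eps_rescale[OF bounded_borelD(1)[OF W(2)]] c by auto
  then show ?thesis
    using second_difference_bound_smoothing[OF W(1) g_bounded_borel
        second_difference_bound_of_derivative[OF g_deriv1 g_deriv2 g2_le]] by simp
qed

section \<open>Decoupling for truncated processes and passage to the limit\<close>

definition trunc :: "nat \<Rightarrow> nat \<Rightarrow> 'a \<Rightarrow> real" where
  "trunc N n \<omega> = (\<Sum>l<N. a l * eps (int n - int l) \<omega>)"

text \<open>Extending the weights by zero writes truncations at different times as sums over one
  common finite set of innovations, on which the replacement argument runs.\<close>

definition coef :: "nat \<Rightarrow> nat \<Rightarrow> int \<Rightarrow> real" where
  "coef N n m = (if int n - int N < m \<and> m \<le> int n then a (nat (int n - m)) else 0)"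

lemma trunc_measurable[measurable]: "trunc N n \<in> borel_measurable M"
  unfolding trunc_def by measurable

lemma window_image: "{int n - int N<..int n} = (\<lambda>l. int n - int l) ` {..<N}"
proof -
  have "m \<in> (\<lambda>l. int n - int l) ` {..<N}" if "int n - int N < m" "m \<le> int n" for m
    using that by (intro image_eqI[of _ _ "nat (int n - m)"]) auto
  then show ?thesis by auto
qed

lemma sum_coef:
  assumes J: "finite J" "{int n - int N<..int n} \<subseteq> J"
  shows "(\<Sum>m\<in>J. coef N n m * u m) = (\<Sum>l<N. a l * u (int n - int l))"
proof -
  have "(\<Sum>m\<in>J. coef N n m * u m) = (\<Sum>m\<in>{int n - int N<..int n}. coef N n m * u m)"
    using J by (intro sum.mono_neutral_right) (auto simp: coef_def)
  also have "\<dots> = (\<Sum>l<N. coef N n (int n - int l) * u (int n - int l))"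
    unfolding window_image by (subst sum.reindex) (auto simp: inj_on_def)
  also have "\<dots> = (\<Sum>l<N. a l * u (int n - int l))"
    by (intro sum.cong) (auto simp: coef_def)
  finally show ?thesis .
qed

text \<open>One innovation of the later time is spent on smoothing \<open>W\<close>; the replacement
  argument then runs over the remaining indices \<open>J'\<close>. N > k keeps the smoothing
  innovation inside the truncation window.\<close>

lemma trunc_decoupling:
  assumes ij: "i < j" and N: "N > k" and W: "integrable lborel W" "bounded_borel W"
  shows "\<bar>expectation (\<lambda>\<omega>. W (trunc N j \<omega> - trunc N i \<omega>))
          - expectation (\<lambda>\<omega>. expectation (\<lambda>\<omega>'. W (trunc N j \<omega> - trunc N i \<omega>')))\<bar>
      \<le> 2 * (F2 / \<bar>a k\<bar> ^ 3 * (\<integral>y. \<bar>W y\<bar> \<partial>lborel)) * \<sigma> * (\<Sum>l<N. \<bar>a l\<bar> * \<bar>a (l + (j - i))\<bar>)"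
proof -
  define C where "C = F2 / \<bar>a k\<bar> ^ 3 * (\<integral>y. \<bar>W y\<bar> \<partial>lborel)"
  have C: "C \<ge> 0" unfolding C_def using F2_nonneg by auto
  define J where "J = {int i - int N<..int j}"
  define v b where "v = coef N j" and "b = coef N i"
  define m0 where "m0 = int j - int k"
  define J' where "J' = J - {m0}"
  have J: "finite J" "J = insert m0 J'" "m0 \<notin> J'" "finite J'"
    using ij N by (auto simp: J_def J'_def m0_def)
  have sub: "{int j - int N<..int j} \<subseteq> J" "{int i - int N<..int i} \<subseteq> J"
    using ij by (auto simp: J_def)
  have v0: "v m0 = a k" using N by (simp add: v_def coef_def m0_def)
  \<comment> \<open>Within the window of \<open>i\<close>, the weight at \<open>m0\<close> is that
    of index k - (j - i) < k, which vanishes by minimality of \<open>k\<close>.\<close>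
  have b0: "b m0 = 0" using ij a_below_k by (auto simp: b_def coef_def m0_def)
  have tj: "trunc N j \<omega> = (\<Sum>m\<in>J. v m * eps m \<omega>)" for \<omega>
    unfolding trunc_def v_def using sum_coef[OF J(1) sub(1), of "\<lambda>m. eps m \<omega>"] by simp
  have ti: "trunc N i \<omega> = (\<Sum>m\<in>J. b m * eps m \<omega>)" for \<omega>
    unfolding trunc_def b_def using sum_coef[OF J(1) sub(2), of "\<lambda>m. eps m \<omega>"] by simp
  define \<phi> where "\<phi> = avg v {m0} W"
  have \<phi>: "bounded_borel \<phi>" "second_difference_bound C \<phi>"
    unfolding \<phi>_def C_def using avg_bounded_borel[OF W(2)] avg_smoothing[of W v m0] W v0 by auto
  have 1: "expectation (\<lambda>\<omega>. W (trunc N j \<omega> - trunc N i \<omega>)) = avg (\<lambda>m. v m - b m) J' \<phi> 0"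
  proof -
    have "expectation (\<lambda>\<omega>. W (trunc N j \<omega> - trunc N i \<omega>)) = avg (\<lambda>m. v m - b m) (insert m0 J') W 0"
      unfolding tj ti J(2)[symmetric] avg_def by (simp add: sum_subtractf left_diff_distrib)
    also have "\<dots> = avg (\<lambda>m. v m - b m) J' (avg (\<lambda>m. v m - b m) {m0} W) 0"
      using J W by (intro avg_insert) auto
    also have "avg (\<lambda>m. v m - b m) {m0} W = \<phi>"
      by (simp add: \<phi>_def avg_def b0 fun_eq_iff)
    finally show ?thesis .
  qed
  have 2: "expectation (\<lambda>\<omega>. expectation (\<lambda>\<omega>'. W (trunc N j \<omega> - trunc N i \<omega>')))
      = avg v J' (avg (\<lambda>m. - b m) J' \<phi>) 0"
  proof -
    have "expectation (\<lambda>\<omega>. expectation (\<lambda>\<omega>'. W (trunc N j \<omega> - trunc N i \<omega>')))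
        = avg v J (avg (\<lambda>m. - b m) J W) 0"
      unfolding tj ti avg_def by (simp add: sum_negf)
    also have "avg (\<lambda>m. - b m) J W = avg (\<lambda>m. - b m) J' W"
      unfolding J(2) avg_def using J b0 by simp
    also have "avg v J (avg (\<lambda>m. - b m) J' W) 0 = avg v J' (avg v {m0} (avg (\<lambda>m. - b m) J' W)) 0"
      unfolding J(2) using J W by (intro avg_insert avg_bounded_borel) auto
    also have "avg v {m0} (avg (\<lambda>m. - b m) J' W) = avg (\<lambda>m. - b m) J' \<phi>"
      unfolding \<phi>_def using W by (intro ext avg_commute)
    finally show ?thesis .
  qed
  have "(\<Sum>m\<in>J'. \<bar>v m\<bar> * \<bar>b m\<bar>) \<le> (\<Sum>m\<in>J. \<bar>v m\<bar> * \<bar>b m\<bar>)"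
    using J by (intro sum_mono2) auto
  also have "\<dots> = (\<Sum>m\<in>{int i - int N<..int i}. \<bar>v m\<bar> * \<bar>b m\<bar>)"
    using J(1) sub by (intro sum.mono_neutral_right) (auto simp: b_def coef_def)
  also have "\<dots> = (\<Sum>l<N. \<bar>v (int i - int l)\<bar> * \<bar>b (int i - int l)\<bar>)"
    unfolding window_image by (subst sum.reindex) (auto simp: inj_on_def)
  \<comment> \<open>Only an inequality, since truncation sets \<open>v\<close> to zero where l + (j
    - i) \<ge> N.\<close>
  also have "\<dots> \<le> (\<Sum>l<N. \<bar>a l\<bar> * \<bar>a (l + (j - i))\<bar>)"
  proof (rule sum_mono)
    fix l assume "l \<in> {..<N}"
    have e: "nat (int j - (int i - int l)) = l + (j - i)" using ij by auto
    show "\<bar>v (int i - int l)\<bar> * \<bar>b (int i - int l)\<bar> \<le> \<bar>a l\<bar> * \<bar>a (l + (j - i))\<bar>"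
      using \<open>l \<in> {..<N}\<close> by (auto simp: v_def b_def coef_def e)
  qed
  finally have s: "(\<Sum>m\<in>J'. \<bar>v m\<bar> * \<bar>b m\<bar>) \<le> (\<Sum>l<N. \<bar>a l\<bar> * \<bar>a (l + (j - i))\<bar>)" .
  have "\<bar>avg (\<lambda>m. v m - b m) J' \<phi> 0 - avg v J' (avg (\<lambda>m. - b m) J' \<phi>) 0\<bar>
      \<le> 2 * C * \<sigma> * (\<Sum>m\<in>J'. \<bar>v m\<bar> * \<bar>b m\<bar>)"
    by (rule avg_decoupling[OF J(4) C \<phi>])
  also have "\<dots> \<le> 2 * C * \<sigma> * (\<Sum>l<N. \<bar>a l\<bar> * \<bar>a (l + (j - i))\<bar>)"
    using s C \<sigma>_nonneg by (intro mult_left_mono) auto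
  finally show ?thesis unfolding 1 2 C_def .
qed

text \<open>First absolute moments are bounded by 1 + \<sigma>, so the series of absolute values has
  finite expectation and converges almost surely. The quantifier over \<open>n\<close> sits inside
  \<open>AE\<close> because two times are always considered together.\<close>

lemma AE_trunc_tendsto: "AE \<omega> in M. \<forall>n. (\<lambda>N. trunc N n \<omega>) \<longlonglongrightarrow> X n \<omega>"
  unfolding AE_all_countable
proof
  fix n
  have e: "(\<integral>\<^sup>+\<omega>. ennreal \<bar>eps i \<omega>\<bar> \<partial>M) \<le> ennreal (1 + \<sigma>)" for i
  proof -
    have "(\<integral>\<^sup>+\<omega>. ennreal \<bar>eps i \<omega>\<bar> \<partial>M) \<le> (\<integral>\<^sup>+\<omega>. ennreal (1 + (eps i \<omega>)\<^sup>2) \<partial>M)"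
    proof (intro nn_integral_mono ennreal_leI)
      fix \<omega>
      have "2 * \<bar>eps i \<omega>\<bar> \<le> 1 + (eps i \<omega>)\<^sup>2" using sum_squares_bound[of 1 "\<bar>eps i \<omega>\<bar>"] by simp
      then show "\<bar>eps i \<omega>\<bar> \<le> 1 + (eps i \<omega>)\<^sup>2" by linarith
    qed
    also have "\<dots> = ennreal (expectation (\<lambda>\<omega>. 1 + (eps i \<omega>)\<^sup>2))"
      using eps_sq_integrable by (intro nn_integral_eq_integral) auto
    also have "\<dots> \<le> ennreal (1 + \<sigma>)"
      using eps_sq_integrable eps_sq_le by (intro ennreal_leI) (simp add: prob_space)
    finally show ?thesis .
  qed
  have "(\<integral>\<^sup>+\<omega>. (\<Sum>l. ennreal (\<bar>a l\<bar> * \<bar>eps (int n - int l) \<omega>\<bar>)) \<partial>M)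
      = (\<Sum>l. \<integral>\<^sup>+\<omega>. ennreal (\<bar>a l\<bar> * \<bar>eps (int n - int l) \<omega>\<bar>) \<partial>M)"
    by (rule nn_integral_suminf) measurable
  also have "\<dots> \<le> (\<Sum>l. ennreal \<bar>a l\<bar> * ennreal (1 + \<sigma>))"
  proof (intro suminf_le)
    fix l
    have "(\<integral>\<^sup>+\<omega>. ennreal (\<bar>a l\<bar> * \<bar>eps (int n - int l) \<omega>\<bar>) \<partial>M)
        = ennreal \<bar>a l\<bar> * (\<integral>\<^sup>+\<omega>. ennreal \<bar>eps (int n - int l) \<omega>\<bar> \<partial>M)"
      by (subst nn_integral_cmult[symmetric]) (auto simp: ennreal_mult)
    then show "(\<integral>\<^sup>+\<omega>. ennreal (\<bar>a l\<bar> * \<bar>eps (int n - int l) \<omega>\<bar>) \<partial>M) \<le> ennreal \<bar>a l\<bar> * ennreal (1 + \<sigma>)"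
      using e by (simp add: mult_left_mono)
  qed auto
  also have "\<dots> = ennreal (\<Sum>l. \<bar>a l\<bar>) * ennreal (1 + \<sigma>)"
    using a_abs by (simp add: suminf_ennreal_eq[of _ "\<Sum>l. \<bar>a l\<bar>"] summable_sums)
  also have "\<dots> < \<top>" by (simp add: ennreal_mult_less_top)
  finally have fin: "(\<integral>\<^sup>+\<omega>. (\<Sum>l. ennreal (\<bar>a l\<bar> * \<bar>eps (int n - int l) \<omega>\<bar>)) \<partial>M) \<noteq> \<infinity>" by simp
  have "AE \<omega> in M. (\<Sum>l. ennreal (\<bar>a l\<bar> * \<bar>eps (int n - int l) \<omega>\<bar>)) \<noteq> \<infinity>"
    by (rule nn_integral_noteq_infinite[OF _ fin]) measurable
  then show "AE \<omega> in M. (\<lambda>N. trunc N n \<omega>) \<longlonglongrightarrow> X n \<omega>"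
  proof eventually_elim
    case (elim \<omega>)
    then have "summable (\<lambda>l. \<bar>a l * eps (int n - int l) \<omega>\<bar>)"
      by (intro summable_suminf_not_top) (auto simp: abs_mult)
    then have "summable (\<lambda>l. a l * eps (int n - int l) \<omega>)" by (rule summable_rabs_cancel)
    then show ?case
      unfolding trunc_def linproc_def by (rule summable_LIMSEQ)
  qed
qed

lemma summable_lag: "summable (\<lambda>l. \<bar>a l\<bar> * \<bar>a (l + d)\<bar>)"
proof (rule summable_comparison_test')
  show "summable (\<lambda>l. \<bar>a l\<bar> * (\<Sum>l. \<bar>a l\<bar>))" using a_abs by (rule summable_mult2)
  fix l :: nat
  have "\<bar>a (l + d)\<bar> \<le> (\<Sum>l. \<bar>a l\<bar>)"
    using sum_le_suminf[OF a_abs, of "{l + d}"] by simp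
  then show "norm (\<bar>a l\<bar> * \<bar>a (l + d)\<bar>) \<le> \<bar>a l\<bar> * (\<Sum>l. \<bar>a l\<bar>)"
    by (simp add: mult_left_mono)
qed

text \<open>Continuity and boundedness of \<open>W\<close> let both expectations converge as N
  grows; the nested one needs dominated convergence inside and outside.\<close>

lemma decoupling:
  assumes ij: "i < j" and W: "integrable lborel W" "bounded_borel W" "\<And>x. isCont W x"
  shows "\<bar>expectation (\<lambda>\<omega>. W (X j \<omega> - X i \<omega>))
          - expectation (\<lambda>\<omega>. expectation (\<lambda>\<omega>'. W (X j \<omega> - X i \<omega>')))\<bar>
      \<le> 2 * (F2 / \<bar>a k\<bar> ^ 3 * (\<integral>y. \<bar>W y\<bar> \<partial>lborel)) * \<sigma> * (\<Sum>l. \<bar>a l\<bar> * \<bar>a (l + (j - i))\<bar>)"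
proof (rule LIMSEQ_le)
  note [measurable] = bounded_borelD(1)[OF W(2)]
  obtain C where C: "\<And>x. \<bar>W x\<bar> \<le> C" using bounded_borelD(2)[OF W(2)] by auto
  have 1: "(\<lambda>N. expectation (\<lambda>\<omega>. W (trunc N j \<omega> - trunc N i \<omega>))) \<longlonglongrightarrow> expectation (\<lambda>\<omega>. W (X j \<omega> - X i \<omega>))"
  proof (rule integral_dominated_convergence[where w = "\<lambda>_. C"])
    show "AE \<omega> in M. (\<lambda>N. W (trunc N j \<omega> - trunc N i \<omega>)) \<longlonglongrightarrow> W (X j \<omega> - X i \<omega>)"
      using AE_trunc_tendsto
      by eventually_elim (auto intro!: isCont_tendsto_compose[OF W(3)] tendsto_diff)
  qed (use C in auto)
  have 2: "(\<lambda>N. expectation (\<lambda>\<omega>. expectation (\<lambda>\<omega>'. W (trunc N j \<omega> - trunc N i \<omega>'))))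
      \<longlonglongrightarrow> expectation (\<lambda>\<omega>. expectation (\<lambda>\<omega>'. W (X j \<omega> - X i \<omega>')))"
  proof (rule integral_dominated_convergence[where w = "\<lambda>_. C"])
    show "AE \<omega> in M. (\<lambda>N. expectation (\<lambda>\<omega>'. W (trunc N j \<omega> - trunc N i \<omega>')))
        \<longlonglongrightarrow> expectation (\<lambda>\<omega>'. W (X j \<omega> - X i \<omega>'))"
      using AE_trunc_tendsto
    proof eventually_elim
      case (elim \<omega>)
      show ?case
      proof (rule integral_dominated_convergence[where w = "\<lambda>_. C"])
        show "AE \<omega>' in M. (\<lambda>N. W (trunc N j \<omega> - trunc N i \<omega>')) \<longlonglongrightarrow> W (X j \<omega> - X i \<omega>')"
          using AE_trunc_tendsto
          by eventually_elim (use elim in \<open>auto intro!: isCont_tendsto_compose[OF W(3)] tendsto_diff\<close>)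
      qed (use C in auto)
    qed
    show "AE \<omega> in M. norm (expectation (\<lambda>\<omega>'. W (trunc N j \<omega> - trunc N i \<omega>'))) \<le> C" for N
      using C by (intro AE_I2) (simp add: expectation_abs_le)
  qed auto
  show "(\<lambda>N. \<bar>expectation (\<lambda>\<omega>. W (trunc N j \<omega> - trunc N i \<omega>))
          - expectation (\<lambda>\<omega>. expectation (\<lambda>\<omega>'. W (trunc N j \<omega> - trunc N i \<omega>')))\<bar>)
      \<longlonglongrightarrow> \<bar>expectation (\<lambda>\<omega>. W (X j \<omega> - X i \<omega>))
          - expectation (\<lambda>\<omega>. expectation (\<lambda>\<omega>'. W (X j \<omega> - X i \<omega>')))\<bar>"
    by (intro tendsto_rabs tendsto_diff 1 2)
  show "(\<lambda>N. 2 * (F2 / \<bar>a k\<bar> ^ 3 * (\<integral>y. \<bar>W y\<bar> \<partial>lborel)) * \<sigma> * (\<Sum>l<N. \<bar>a l\<bar> * \<bar>a (l + (j - i))\<bar>))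
      \<longlonglongrightarrow> 2 * (F2 / \<bar>a k\<bar> ^ 3 * (\<integral>y. \<bar>W y\<bar> \<partial>lborel)) * \<sigma> * (\<Sum>l. \<bar>a l\<bar> * \<bar>a (l + (j - i))\<bar>)"
    by (intro tendsto_mult_left summable_LIMSEQ summable_lag)
  show "\<exists>N0. \<forall>N\<ge>N0. \<bar>expectation (\<lambda>\<omega>. W (trunc N j \<omega> - trunc N i \<omega>))
          - expectation (\<lambda>\<omega>. expectation (\<lambda>\<omega>'. W (trunc N j \<omega> - trunc N i \<omega>')))\<bar>
      \<le> 2 * (F2 / \<bar>a k\<bar> ^ 3 * (\<integral>y. \<bar>W y\<bar> \<partial>lborel)) * \<sigma> * (\<Sum>l<N. \<bar>a l\<bar> * \<bar>a (l + (j - i))\<bar>)"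
    by (intro exI[of _ "Suc k"] allI impI trunc_decoupling ij W) auto
qed

text \<open>For fixed \<open>l\<close> the indices l + d are distinct, so exchanging the sums bounds
  the inner one by the full absolute sum. The total cost of decoupling is thus independent of the
  sample size.\<close>

lemma sum_lag_le:
  "(\<Sum>d\<in>{1..n}. \<Sum>l. \<bar>a l\<bar> * \<bar>a (l + d)\<bar>) \<le> (\<Sum>l. \<bar>a l\<bar>)\<^sup>2"
proof -
  have "(\<Sum>d\<in>{1..n}. \<Sum>l. \<bar>a l\<bar> * \<bar>a (l + d)\<bar>) = (\<Sum>l. \<Sum>d\<in>{1..n}. \<bar>a l\<bar> * \<bar>a (l + d)\<bar>)"
    by (rule suminf_sum[symmetric]) (rule summable_lag)
  also have "\<dots> \<le> (\<Sum>l. \<bar>a l\<bar> * (\<Sum>l. \<bar>a l\<bar>))"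
  proof (rule suminf_le)
    fix l
    have "(\<Sum>d\<in>{1..n}. \<bar>a (l + d)\<bar>) = (\<Sum>m\<in>(\<lambda>d. l + d) ` {1..n}. \<bar>a m\<bar>)"
      by (subst sum.reindex) (auto simp: inj_on_def)
    also have "\<dots> \<le> (\<Sum>l. \<bar>a l\<bar>)"
      using a_abs by (intro sum_le_suminf) auto
    finally show "(\<Sum>d\<in>{1..n}. \<bar>a l\<bar> * \<bar>a (l + d)\<bar>) \<le> \<bar>a l\<bar> * (\<Sum>l. \<bar>a l\<bar>)"
      by (simp add: sum_distrib_left[symmetric] mult_left_mono)
  next
    show "summable (\<lambda>l. \<Sum>d\<in>{1..n}. \<bar>a l\<bar> * \<bar>a (l + d)\<bar>)"
      by (intro summable_sum summable_lag)
    show "summable (\<lambda>l. \<bar>a l\<bar> * (\<Sum>l. \<bar>a l\<bar>))" using a_abs by (rule summable_mult2)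
  qed
  also have "\<dots> = (\<Sum>l. \<bar>a l\<bar>)\<^sup>2"
    using suminf_mult2[OF a_abs, of "\<Sum>l. \<bar>a l\<bar>"] by (simp add: power2_eq_square)
  finally show ?thesis .
qed

end

section \<open>Integrated variance and bias\<close>

context linear_process
begin

text \<open>The mean of the estimator at \<open>x\<close>. Time 0 represents every time, since all
  \<open>X n\<close> have the density \<open>f\<close>.\<close>

definition smoothed_density :: "(real \<Rightarrow> real) \<Rightarrow> real \<Rightarrow> real" where
  "smoothed_density \<kappa> x = expectation (\<lambda>\<omega>. \<kappa> (x - X 0 \<omega>))"

lemma expectation_X:
  fixes \<phi> :: "real \<Rightarrow> real"
  assumes [measurable]: "\<phi> \<in> borel_measurable borel"
  shows "expectation (\<lambda>\<omega>. \<phi> (X n \<omega>)) = expectation (\<lambda>\<omega>. \<phi> (X 0 \<omega>))"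
proof -
  have "expectation (\<lambda>\<omega>. \<phi> (X n \<omega>)) = (\<integral>x. f x * \<phi> x \<partial>lborel)" for n
    by (rule distributed_integral[OF X_dens, symmetric]) (use f_nonneg in auto)
  then show ?thesis by metis
qed

text \<open>The product of means is an expectation over two independent copies, so the integrated
  covariance compares \<open>autocorr \<kappa>\<close> under the joint and the decoupled law. The
  crude second bound is of order 1/h and is kept for the diagonal; the third is free of h.\<close>

lemma integrated_covariance:
  assumes "bounded_kernel \<kappa> B"
  defines "q \<equiv> smoothed_density \<kappa>"
  defines "t \<equiv> \<lambda>i j x. expectation (\<lambda>\<omega>. \<kappa> (x - X i \<omega>) * \<kappa> (x - X j \<omega>)) - (q x)\<^sup>2"
  shows "integrable lborel (t i j)"
    and "\<bar>\<integral>x. t i j x \<partial>lborel\<bar> \<le> 2 * B * (\<integral>x. \<bar>\<kappa> x\<bar> \<partial>lborel)"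
    and "j < i \<Longrightarrow> \<bar>\<integral>x. t i j x \<partial>lborel\<bar>
      \<le> 2 * (F2 / \<bar>a k\<bar> ^ 3 * (\<integral>x. \<bar>\<kappa> x\<bar> \<partial>lborel)\<^sup>2) * \<sigma> * (\<Sum>l. \<bar>a l\<bar> * \<bar>a (l + (i - j))\<bar>)"
proof -
  interpret bounded_kernel \<kappa> B by fact
  interpret P: pair_prob_space M M ..
  let ?W = "autocorr \<kappa>"
  have q: "expectation (\<lambda>\<omega>. \<kappa> (x - X n \<omega>)) = q x" for x n
    unfolding q_def smoothed_density_def by (rule expectation_X) measurable
  have q2: "(\<integral>p. \<kappa> (x - X i (fst p)) * \<kappa> (x - X j (snd p)) \<partial>(M \<Otimes>\<^sub>M M)) = (q x)\<^sup>2" for x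
  proof -
    have "\<bar>\<kappa> y * \<kappa> z\<bar> \<le> B * B" for y z
      using mult_mono[OF \<kappa>_le \<kappa>_le B_nonneg] by (simp add: abs_mult)
    then have "integrable (M \<Otimes>\<^sub>M M) (\<lambda>p. \<kappa> (x - X i (fst p)) * \<kappa> (x - X j (snd p)))"
      by (intro P.integrable_bounded) auto
    from P.integral_fst'[OF this] show ?thesis by (simp add: q power2_eq_square)
  qed
  have WP: "(\<integral>p. ?W (X i (fst p) - X j (snd p)) \<partial>(M \<Otimes>\<^sub>M M))
      = expectation (\<lambda>\<omega>. expectation (\<lambda>\<omega>'. ?W (X i \<omega> - X j \<omega>')))"
  proof -
    have "integrable (M \<Otimes>\<^sub>M M) (\<lambda>p. ?W (X i (fst p) - X j (snd p)))"
      by (intro P.integrable_bounded[OF _ autocorr_le]) measurable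
    from P.integral_fst'[OF this] show ?thesis by simp
  qed
  note 1 = expectation_product_integral[OF prob_space_axioms X_measurable[of i] X_measurable[of j]]
  have pm: "prob_space (M \<Otimes>\<^sub>M M)" by (rule P.prob_space_axioms)
  have 2: "integrable lborel (\<lambda>x. (q x)\<^sup>2)"
      "(\<integral>x. (q x)\<^sup>2 \<partial>lborel) = expectation (\<lambda>\<omega>. expectation (\<lambda>\<omega>'. ?W (X i \<omega> - X j \<omega>')))"
    using expectation_product_integral[OF pm, of "\<lambda>p. X i (fst p)" "\<lambda>p. X j (snd p)"]
    by (simp_all add: q2 WP)
  show int: "integrable lborel (t i j)"
    unfolding t_def using 1(1) 2(1) by simp
  have eq: "(\<integral>x. t i j x \<partial>lborel) = expectation (\<lambda>\<omega>. ?W (X i \<omega> - X j \<omega>))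
      - expectation (\<lambda>\<omega>. expectation (\<lambda>\<omega>'. ?W (X i \<omega> - X j \<omega>')))"
    unfolding t_def using 1 2 by simp
  have "\<bar>expectation (\<lambda>\<omega>. ?W (X i \<omega> - X j \<omega>))\<bar> \<le> B * L1"
    by (rule expectation_abs_le) (rule autocorr_le)
  moreover have "\<bar>expectation (\<lambda>\<omega>. expectation (\<lambda>\<omega>'. ?W (X i \<omega> - X j \<omega>')))\<bar> \<le> B * L1"
    by (intro expectation_abs_le autocorr_le)
  ultimately show "\<bar>\<integral>x. t i j x \<partial>lborel\<bar> \<le> 2 * B * L1"
    unfolding eq by linarith
  assume ji: "j < i"
  have c: "(\<Sum>l. \<bar>a l\<bar> * \<bar>a (l + (i - j))\<bar>) \<ge> 0"
    by (rule suminf_nonneg[OF summable_lag]) simp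
  have "\<bar>\<integral>x. t i j x \<partial>lborel\<bar>
      \<le> 2 * (F2 / \<bar>a k\<bar> ^ 3 * (\<integral>y. \<bar>?W y\<bar> \<partial>lborel)) * \<sigma> * (\<Sum>l. \<bar>a l\<bar> * \<bar>a (l + (i - j))\<bar>)"
    unfolding eq by (rule decoupling[OF ji autocorr_L1(1) autocorr_bounded_borel autocorr_isCont])
  also have "\<dots> \<le> 2 * (F2 / \<bar>a k\<bar> ^ 3 * L1\<^sup>2) * \<sigma> * (\<Sum>l. \<bar>a l\<bar> * \<bar>a (l + (i - j))\<bar>)"
    using autocorr_L1(2) F2_nonneg \<sigma>_nonneg c
    by (intro mult_right_mono mult_left_mono) auto
  finally show "\<bar>\<integral>x. t i j x \<partial>lborel\<bar>
      \<le> 2 * (F2 / \<bar>a k\<bar> ^ 3 * L1\<^sup>2) * \<sigma> * (\<Sum>l. \<bar>a l\<bar> * \<bar>a (l + (i - j))\<bar>)" .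
qed

text \<open>Expanding the square gives n diagonal terms of cost 2 B L1. The off-diagonal terms of
  each row sum to at most 2 D times the squared absolute sum of the coefficients, one D for each
  side of the diagonal.\<close>

lemma integrated_variance_le:
  assumes "bounded_kernel \<kappa> B" and n: "n > 0"
  shows "(\<integral>\<^sup>+\<omega>. \<integral>\<^sup>+x. ennreal (((1 / real n) * (\<Sum>i=1..n. \<kappa> (x - X i \<omega>)) - smoothed_density \<kappa> x)\<^sup>2) \<partial>lborel \<partial>M)
    \<le> ennreal ((2 * B * (\<integral>x. \<bar>\<kappa> x\<bar> \<partial>lborel)
        + 4 * (F2 / \<bar>a k\<bar> ^ 3 * (\<integral>x. \<bar>\<kappa> x\<bar> \<partial>lborel)\<^sup>2) * \<sigma> * (\<Sum>l. \<bar>a l\<bar>)\<^sup>2) / real n)"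
proof -
  interpret bounded_kernel \<kappa> B by fact
  define q where "q = smoothed_density \<kappa>"
  define t where "t i j x = expectation (\<lambda>\<omega>. \<kappa> (x - X i \<omega>) * \<kappa> (x - X j \<omega>)) - (q x)\<^sup>2" for i j x
  note t = integrated_covariance[OF assms(1), folded q_def, folded t_def]
  have t_sym: "t i j x = t j i x" for i j x by (simp add: t_def mult.commute)
  define D where "D = 2 * (F2 / \<bar>a k\<bar> ^ 3 * L1\<^sup>2) * \<sigma>"
  define c where "c d = (\<Sum>l. \<bar>a l\<bar> * \<bar>a (l + d)\<bar>)" for d
  define \<tau> where "\<tau> i j = (\<integral>x. t i j x \<partial>lborel)" for i j
  have D: "D \<ge> 0" using F2_nonneg \<sigma>_nonneg by (simp add: D_def)
  have c: "c d \<ge> 0" for d unfolding c_def by (rule suminf_nonneg[OF summable_lag]) simp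
  have [measurable]: "q \<in> borel_measurable borel" unfolding q_def smoothed_density_def by measurable
  have q: "expectation (\<lambda>\<omega>. \<kappa> (x - X i \<omega>)) = q x" for x i
    unfolding q_def smoothed_density_def by (rule expectation_X) measurable
  have \<tau>1: "\<bar>\<tau> i i\<bar> \<le> 2 * B * L1" for i unfolding \<tau>_def by (rule t(2))
  have \<tau>2: "\<bar>\<tau> i j\<bar> \<le> D * c (i - j)" if "j < i" for i j
    using t(3)[OF that] by (simp add: \<tau>_def D_def c_def)
  have \<tau>3: "\<bar>\<tau> i j\<bar> \<le> D * c (j - i)" if "i < j" for i j
    using \<tau>2[OF that] by (simp add: \<tau>_def t_sym[of i j])
  have csum: "(\<Sum>d\<in>{1..n}. c d) \<le> (\<Sum>l. \<bar>a l\<bar>)\<^sup>2" unfolding c_def by (rule sum_lag_le)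
  have row: "(\<Sum>j=1..n. \<bar>\<tau> i j\<bar>) \<le> 2 * B * L1 + 2 * D * (\<Sum>l. \<bar>a l\<bar>)\<^sup>2" if i: "i \<in> {1..n}" for i
  proof -
    have eq: "{1..n} = insert i ({1..<i} \<union> {i<..n})" using i by auto
    have "(\<Sum>j\<in>{1..<i} \<union> {i<..n}. \<bar>\<tau> i j\<bar>) = (\<Sum>j\<in>{1..<i}. \<bar>\<tau> i j\<bar>) + (\<Sum>j\<in>{i<..n}. \<bar>\<tau> i j\<bar>)"
      by (rule sum.union_disjoint) auto
    then have "(\<Sum>j=1..n. \<bar>\<tau> i j\<bar>) = \<bar>\<tau> i i\<bar> + ((\<Sum>j\<in>{1..<i}. \<bar>\<tau> i j\<bar>) + (\<Sum>j\<in>{i<..n}. \<bar>\<tau> i j\<bar>))"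
      unfolding eq by (subst sum.insert) auto
    moreover have "(\<Sum>j\<in>{1..<i}. \<bar>\<tau> i j\<bar>) \<le> D * (\<Sum>l. \<bar>a l\<bar>)\<^sup>2"
    proof -
      have "(\<Sum>j\<in>{1..<i}. \<bar>\<tau> i j\<bar>) \<le> (\<Sum>j\<in>{1..<i}. D * c (i - j))"
        using \<tau>2 by (intro sum_mono) auto
      also have "\<dots> = D * (\<Sum>d\<in>(\<lambda>j. i - j) ` {1..<i}. c d)"
        by (subst sum.reindex) (auto simp: inj_on_def sum_distrib_left)
      also have "\<dots> \<le> D * (\<Sum>d\<in>{1..n}. c d)"
        using i c D by (intro mult_left_mono sum_mono2) auto
      finally show ?thesis using csum D by (meson mult_left_mono order_trans)
    qed
    moreover have "(\<Sum>j\<in>{i<..n}. \<bar>\<tau> i j\<bar>) \<le> D * (\<Sum>l. \<bar>a l\<bar>)\<^sup>2"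
    proof -
      have "(\<Sum>j\<in>{i<..n}. \<bar>\<tau> i j\<bar>) \<le> (\<Sum>j\<in>{i<..n}. D * c (j - i))"
        using \<tau>3 by (intro sum_mono) auto
      also have "\<dots> = D * (\<Sum>d\<in>(\<lambda>j. j - i) ` {i<..n}. c d)"
        by (subst sum.reindex) (auto simp: inj_on_def sum_distrib_left)
      also have "\<dots> \<le> D * (\<Sum>d\<in>{1..n}. c d)"
        using i c D by (intro mult_left_mono sum_mono2) auto
      finally show ?thesis using csum D by (meson mult_left_mono order_trans)
    qed
    ultimately show ?thesis using \<tau>1[of i] by linarith
  qed
  define V where "V x = (1 / (real n)\<^sup>2) * (\<Sum>i=1..n. \<Sum>j=1..n. t i j x)" for x
  have V: "(\<integral>\<^sup>+\<omega>. ennreal (((1 / real n) * (\<Sum>i=1..n. \<kappa> (x - X i \<omega>)) - q x)\<^sup>2) \<partial>M) = ennreal (V x)"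
    and V0: "V x \<ge> 0" for x
  proof -
    define y where "y i \<omega> = \<kappa> (x - X i \<omega>) - q x" for i \<omega>
    have ki: "integrable M (\<lambda>\<omega>. \<kappa> (x - X i \<omega>))" for i
      by (rule integrable_bounded[OF _ \<kappa>_le]) measurable
    have "\<bar>\<kappa> y * \<kappa> z\<bar> \<le> B * B" for y z
      using mult_mono[OF \<kappa>_le \<kappa>_le B_nonneg] by (simp add: abs_mult)
    then have kki: "integrable M (\<lambda>\<omega>. \<kappa> (x - X i \<omega>) * \<kappa> (x - X j \<omega>))" for i j
      by (intro integrable_bounded) auto
    have ye: "y i \<omega> * y j \<omega> = \<kappa> (x - X i \<omega>) * \<kappa> (x - X j \<omega>) - q x * \<kappa> (x - X i \<omega>) - q x * \<kappa> (x - X j \<omega>) + (q x)\<^sup>2" for i j \<omega>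
      by (simp add: y_def power2_eq_square algebra_simps)
    have yi: "integrable M (\<lambda>\<omega>. y i \<omega> * y j \<omega>)" for i j
      unfolding ye using ki kki by simp
    have yt: "expectation (\<lambda>\<omega>. y i \<omega> * y j \<omega>) = t i j x" for i j
      unfolding ye using ki kki by (simp add: q t_def prob_space power2_eq_square)
    have sq: "((1 / real n) * (\<Sum>i=1..n. \<kappa> (x - X i \<omega>)) - q x)\<^sup>2
        = (1 / (real n)\<^sup>2) * (\<Sum>i=1..n. \<Sum>j=1..n. y i \<omega> * y j \<omega>)" for \<omega>
    proof -
      have "(1 / real n) * (\<Sum>i=1..n. \<kappa> (x - X i \<omega>)) - q x = (1 / real n) * (\<Sum>i=1..n. y i \<omega>)"
        using n by (simp add: y_def sum_subtractf field_simps)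
      then show ?thesis by (simp add: power2_eq_square sum_product power_mult_distrib)
    qed
    have "expectation (\<lambda>\<omega>. ((1 / real n) * (\<Sum>i=1..n. \<kappa> (x - X i \<omega>)) - q x)\<^sup>2) = V x"
      unfolding sq V_def using yi by (simp add: yt)
    moreover have "integrable M (\<lambda>\<omega>. ((1 / real n) * (\<Sum>i=1..n. \<kappa> (x - X i \<omega>)) - q x)\<^sup>2)"
      unfolding sq using yi by simp
    \<comment> \<open>Rewriting \<open>V x\<close> back into the expectation of a square also yields
      its sign.\<close>
    ultimately show "(\<integral>\<^sup>+\<omega>. ennreal (((1 / real n) * (\<Sum>i=1..n. \<kappa> (x - X i \<omega>)) - q x)\<^sup>2) \<partial>M) = ennreal (V x)"
      and "V x \<ge> 0"
      by (auto simp: nn_integral_eq_integral simp flip: \<open>_ = V x\<close>)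
  qed
  have V_int: "integrable lborel V"
    unfolding V_def using t(1) by simp
  have "(\<integral>x. V x \<partial>lborel) = (1 / (real n)\<^sup>2) * (\<Sum>i=1..n. \<Sum>j=1..n. \<tau> i j)"
    unfolding V_def \<tau>_def using t(1) by simp
  also have "\<dots> \<le> (1 / (real n)\<^sup>2) * (\<Sum>i=1..n. \<Sum>j=1..n. \<bar>\<tau> i j\<bar>)"
    by (intro mult_left_mono sum_mono) auto
  also have "\<dots> \<le> (1 / (real n)\<^sup>2) * (\<Sum>i=1..n. 2 * B * L1 + 2 * D * (\<Sum>l. \<bar>a l\<bar>)\<^sup>2)"
    by (intro mult_left_mono sum_mono row) auto
  also have "\<dots> = (2 * B * L1 + 2 * D * (\<Sum>l. \<bar>a l\<bar>)\<^sup>2) / real n"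
    using n by (simp add: power2_eq_square)
  finally have V_le: "(\<integral>x. V x \<partial>lborel) \<le> (2 * B * L1 + 2 * D * (\<Sum>l. \<bar>a l\<bar>)\<^sup>2) / real n" .
  interpret P: pair_sigma_finite M "lborel :: real measure" ..
  have "(\<integral>\<^sup>+\<omega>. \<integral>\<^sup>+x. ennreal (((1 / real n) * (\<Sum>i=1..n. \<kappa> (x - X i \<omega>)) - q x)\<^sup>2) \<partial>lborel \<partial>M)
      = (\<integral>\<^sup>+x. \<integral>\<^sup>+\<omega>. ennreal (((1 / real n) * (\<Sum>i=1..n. \<kappa> (x - X i \<omega>)) - q x)\<^sup>2) \<partial>M \<partial>lborel)"
    by (rule P.Fubini'[symmetric], measurable)
  also have "\<dots> = (\<integral>\<^sup>+x. ennreal (V x) \<partial>lborel)" by (simp only: V)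
  also have "\<dots> = ennreal (\<integral>x. V x \<partial>lborel)"
    using V_int V0 by (intro nn_integral_eq_integral) auto
  also have "\<dots> \<le> ennreal ((2 * B * L1 + 2 * D * (\<Sum>l. \<bar>a l\<bar>)\<^sup>2) / real n)"
    by (rule ennreal_leI[OF V_le])
  finally show ?thesis by (simp add: q_def D_def mult.assoc)
qed

section \<open>Isolating one innovation: the marginal density and the bias\<close>

definition R :: "'a \<Rightarrow> real" where
  "R \<omega> = (\<Sum>l. if l = k then 0 else a l * eps (int 0 - int l) \<omega>)"

lemma R_measurable[measurable]: "R \<in> borel_measurable M"
  unfolding R_def by measurable

text \<open>\<open>R\<close> omits the index \<open>k\<close> termwise, instead of subtracting that
  term from the series, so it is visibly a measurable function of the innovations at the other
  indices.\<close>

lemma indep_eps_R: "indep_var borel (\<lambda>\<omega>. a k * eps (- int k) \<omega>) borel R"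
proof -
  let ?A = "{- int k}" and ?B = "UNIV - {- int k}"
  have A: "(\<lambda>u. a k * u (- int k)) \<in> borel_measurable (PiM ?A (\<lambda>_. borel))"
    by measurable
  have B: "(\<lambda>u. \<Sum>l. if l = k then 0 else a l * u (int 0 - int l)) \<in> borel_measurable (PiM ?B (\<lambda>_. borel))"
  proof (rule borel_measurable_suminf)
    fix l
    show "(\<lambda>u. if l = k then 0 else a l * u (int 0 - int l)) \<in> borel_measurable (PiM ?B (\<lambda>_. borel))"
    proof (cases "l = k")
      case False
      then have "int 0 - int l \<in> ?B" by auto
      then have "(\<lambda>u. u (int 0 - int l)) \<in> borel_measurable (PiM ?B (\<lambda>_. borel))"
        by (rule measurable_component_singleton)
      then show ?thesis using False by simp
    qed simp
  qed
  have "indep_var borel ((\<lambda>u. a k * u (- int k)) \<circ> (\<lambda>\<omega>. restrict (\<lambda>i. eps i \<omega>) ?A))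
          borel ((\<lambda>u. \<Sum>l. if l = k then 0 else a l * u (int 0 - int l)) \<circ> (\<lambda>\<omega>. restrict (\<lambda>i. eps i \<omega>) ?B))"
    by (rule indep_var_compose[OF indep_var_restrict[OF eps_indep] A B]) auto
  moreover have "(\<lambda>u. \<Sum>l. if l = k then 0 else a l * u (int 0 - int l)) \<circ> (\<lambda>\<omega>. restrict (\<lambda>i. eps i \<omega>) ?B) = R"
    unfolding R_def comp_def by (intro ext suminf_cong) auto
  ultimately show ?thesis by (simp add: comp_def)
qed

lemma AE_X_decomp: "AE \<omega> in M. X 0 \<omega> = a k * eps (- int k) \<omega> + R \<omega>"
  using AE_trunc_tendsto
proof eventually_elim
  case (elim \<omega>)
  let ?u = "\<lambda>l. a l * eps (int 0 - int l) \<omega>"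
  have u: "?u sums X 0 \<omega>" using elim[rule_format, of 0] by (simp add: sums_def trunc_def)
  have s: "(\<lambda>l. if l = k then ?u l else 0) sums ?u k" by (rule sums_single)
  have "(\<lambda>l. ?u l - (if l = k then ?u l else 0)) sums (X 0 \<omega> - ?u k)"
    by (rule sums_diff[OF u s])
  also have "(\<lambda>l. ?u l - (if l = k then ?u l else 0)) = (\<lambda>l. if l = k then 0 else ?u l)" by auto
  finally have "R \<omega> = X 0 \<omega> - ?u k" unfolding R_def by (rule sums_unique[symmetric])
  then show ?case by simp
qed

text \<open>By independence the average of translates of \<open>g\<close> is also a density of
  \<open>X 0\<close>, and densities agree almost everywhere.\<close>

lemma AE_density_eq: "AE x in lborel. f x = expectation (\<lambda>\<omega>. g (x - R \<omega>))"
proof -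
  have [measurable]: "(\<lambda>x. ennreal (f x)) \<in> borel_measurable lborel"
    using distributed_borel_measurable[OF X_dens] .
  interpret P: pair_sigma_finite M "lborel :: real measure" ..
  have "density lborel (\<lambda>x. ennreal (f x)) = density lborel (\<lambda>x. \<integral>\<^sup>+\<omega>. ennreal (g (x - R \<omega>)) \<partial>M)"
  proof (rule measure_eqI)
    fix S assume "S \<in> sets (density lborel (\<lambda>x. ennreal (f x)))"
    then have [measurable]: "S \<in> sets borel" by simp
    have "emeasure (density lborel (\<lambda>x. ennreal (f x))) S = (\<integral>\<^sup>+x. ennreal (f x) * indicator S x \<partial>lborel)"
      by (rule emeasure_density) auto
    also have "\<dots> = (\<integral>\<^sup>+\<omega>. indicator S (X 0 \<omega>) \<partial>M)"
      by (rule distributed_nn_integral[OF X_dens]) auto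
    also have "\<dots> = (\<integral>\<^sup>+\<omega>. indicator S (a k * eps (- int k) \<omega> + R \<omega>) \<partial>M)"
      by (rule nn_integral_cong_AE) (use AE_X_decomp in eventually_elim, simp)
    also have "\<dots> = (\<integral>\<^sup>+\<omega>. \<integral>\<^sup>+\<omega>'. indicator S (R \<omega> + a k * eps (- int k) \<omega>') \<partial>M \<partial>M)"
      using indep_var_nn_integral[OF indep_eps_R, of "\<lambda>p. indicator S (fst p + snd p)"]
      by (simp add: add.commute)
    also have "\<dots> = (\<integral>\<^sup>+\<omega>. \<integral>\<^sup>+y. indicator S y * ennreal (g (y - R \<omega>)) \<partial>lborel \<partial>M)"
      by (simp add: nn_integral_eps_rescale)
    also have "\<dots> = (\<integral>\<^sup>+y. \<integral>\<^sup>+\<omega>. indicator S y * ennreal (g (y - R \<omega>)) \<partial>M \<partial>lborel)"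
      by (rule P.Fubini'[symmetric], measurable)
    also have "\<dots> = (\<integral>\<^sup>+y. (\<integral>\<^sup>+\<omega>. ennreal (g (y - R \<omega>)) \<partial>M) * indicator S y \<partial>lborel)"
      by (intro nn_integral_cong) (simp add: nn_integral_cmult mult.commute)
    also have "\<dots> = emeasure (density lborel (\<lambda>x. \<integral>\<^sup>+\<omega>. ennreal (g (x - R \<omega>)) \<partial>M)) S"
      by (rule emeasure_density[symmetric]) auto
    finally show "emeasure (density lborel (\<lambda>x. ennreal (f x))) S
        = emeasure (density lborel (\<lambda>x. \<integral>\<^sup>+\<omega>. ennreal (g (x - R \<omega>)) \<partial>M)) S" .
  qed simp
  then have "AE x in lborel. ennreal (f x) = (\<integral>\<^sup>+\<omega>. ennreal (g (x - R \<omega>)) \<partial>M)"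
    by (intro sigma_finite_measure.density_unique[OF sigma_finite_lborel]) auto
  then show ?thesis
  proof eventually_elim
    case (elim x)
    have "integrable M (\<lambda>\<omega>. g (x - R \<omega>))"
      by (rule integrable_bounded[OF _ g_abs_le]) measurable
    then have "(\<integral>\<^sup>+\<omega>. ennreal (g (x - R \<omega>)) \<partial>M) = ennreal (expectation (\<lambda>\<omega>. g (x - R \<omega>)))"
      using g_nonneg by (intro nn_integral_eq_integral) auto
    then show ?case
      using elim f_nonneg[of x] g_nonneg by (simp add: integral_nonneg_AE)
  qed
qed

lemma AE_density_le: "AE x in lborel. f x \<le> F0 / \<bar>a k\<bar>"
  using AE_density_eq
proof eventually_elim
  case (elim x)
  have "\<bar>expectation (\<lambda>\<omega>. g (x - R \<omega>))\<bar> \<le> F0 / \<bar>a k\<bar>"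
    by (rule expectation_abs_le) (rule g_abs_le)
  then show ?case using elim by linarith
qed

text \<open>The bias is the expectation of the smoothing error of \<open>g\<close> at x - R. Jensen
  moves the square inside, and translation invariance of Lebesgue measure then removes
  \<open>R\<close>.\<close>

lemma integrated_bias_le:
  assumes "bounded_kernel \<kappa> B"
    and \<kappa>: "(\<integral>u. \<kappa> u \<partial>lborel) = 1" "(\<integral>u. u * \<kappa> u \<partial>lborel) = 0"
    and supp: "\<And>u. \<bar>u\<bar> > \<rho> \<Longrightarrow> \<kappa> u = 0" and \<rho>: "\<rho> \<ge> 0"
  shows "(\<integral>\<^sup>+x. ennreal ((smoothed_density \<kappa> x - f x)\<^sup>2) \<partial>lborel)
    \<le> ennreal (4 * (\<integral>u. \<bar>\<kappa> u\<bar> \<partial>lborel)\<^sup>2 * \<rho> ^ 4 * (\<integral>x. (g2 x)\<^sup>2 \<partial>lborel))"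
proof -
  interpret bounded_kernel \<kappa> B by fact
  interpret P: pair_sigma_finite M "lborel :: real measure" ..
  define G where "G y = (\<integral>u. \<kappa> u * g (y - u) \<partial>lborel)" for y
  define \<beta> where "\<beta> y = G y - g y" for y
  have [measurable]: "G \<in> borel_measurable borel" unfolding G_def by measurable
  have [measurable]: "\<beta> \<in> borel_measurable borel" unfolding \<beta>_def by measurable
  have G_le: "\<bar>G y\<bar> \<le> F0 / \<bar>a k\<bar> * L1" for y
  proof -
    have "\<bar>G y\<bar> \<le> (\<integral>u. \<bar>\<kappa> u * g (y - u)\<bar> \<partial>lborel)"
      unfolding G_def by (rule integral_abs_bound)
    also have "\<dots> \<le> (\<integral>u. F0 / \<bar>a k\<bar> * \<bar>\<kappa> u\<bar> \<partial>lborel)"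
    proof (rule integral_mono)
      show "integrable lborel (\<lambda>u. \<bar>\<kappa> u * g (y - u)\<bar>)"
        by (intro integrable_abs integrable_mult_bounded[OF \<kappa>_int _ g_abs_le]) measurable
      show "integrable lborel (\<lambda>u. F0 / \<bar>a k\<bar> * \<bar>\<kappa> u\<bar>)" using \<kappa>_int by auto
      show "\<bar>\<kappa> u * g (y - u)\<bar> \<le> F0 / \<bar>a k\<bar> * \<bar>\<kappa> u\<bar>" for u
        using mult_right_mono[OF g_abs_le[of "y - u"], of "\<bar>\<kappa> u\<bar>"] by (simp add: abs_mult mult.commute)
    qed
    finally show ?thesis by simp
  qed
  have Gi: "integrable M (\<lambda>\<omega>. G (x - R \<omega>))" for x
    by (rule integrable_bounded[OF _ G_le]) measurable
  have gi: "integrable M (\<lambda>\<omega>. g (x - R \<omega>))" for x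
    by (rule integrable_bounded[OF _ g_abs_le]) measurable
  have q: "smoothed_density \<kappa> x = expectation (\<lambda>\<omega>. G (x - R \<omega>))" for x
  proof -
    have b: "bounded_borel (\<lambda>y. \<kappa> (x - y))" unfolding bounded_borel_def using \<kappa>_le by auto
    have "smoothed_density \<kappa> x = expectation (\<lambda>\<omega>. \<kappa> (x - (a k * eps (- int k) \<omega> + R \<omega>)))"
      unfolding smoothed_density_def
      by (rule integral_cong_AE) (measurable, use AE_X_decomp in eventually_elim, simp)
    also have "\<dots> = expectation (\<lambda>\<omega>. expectation (\<lambda>\<omega>'. \<kappa> (x - (a k * eps (- int k) \<omega>' + R \<omega>))))"
      by (rule indep_var_expectation_add[OF indep_eps_R b])
    also have "\<dots> = expectation (\<lambda>\<omega>. \<integral>y. \<kappa> (x - y) * g (y - R \<omega>) \<partial>lborel)"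
      using expectation_eps_rescale[OF bounded_borelD(1)[OF b]] by (simp add: add.commute)
    also have "\<dots> = expectation (\<lambda>\<omega>. G (x - R \<omega>))"
    proof (rule Bochner_Integration.integral_cong)
      fix \<omega>
      show "(\<integral>y. \<kappa> (x - y) * g (y - R \<omega>) \<partial>lborel) = G (x - R \<omega>)"
        using lborel_integral_real_affine[of "-1" "\<lambda>y. \<kappa> (x - y) * g (y - R \<omega>)" x]
        by (simp add: G_def algebra_simps)
    qed simp
    finally show ?thesis .
  qed
  have "(\<integral>\<^sup>+x. ennreal ((smoothed_density \<kappa> x - f x)\<^sup>2) \<partial>lborel)
      \<le> (\<integral>\<^sup>+x. \<integral>\<^sup>+\<omega>. ennreal ((\<beta> (x - R \<omega>))\<^sup>2) \<partial>M \<partial>lborel)"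
  proof (rule nn_integral_mono_AE)
    show "AE x in lborel. ennreal ((smoothed_density \<kappa> x - f x)\<^sup>2) \<le> (\<integral>\<^sup>+\<omega>. ennreal ((\<beta> (x - R \<omega>))\<^sup>2) \<partial>M)"
      using AE_density_eq
    proof eventually_elim
      case (elim x)
      \<comment> \<open>The factor 1 lets Cauchy-Schwarz play the role of Jensen.\<close>
      have e: "smoothed_density \<kappa> x - f x = expectation (\<lambda>\<omega>. \<beta> (x - R \<omega>) * 1)"
        unfolding q elim \<beta>_def using Gi gi by simp
      have b: "\<bar>\<beta> y\<bar> \<le> F0 / \<bar>a k\<bar> * L1 + F0 / \<bar>a k\<bar>" for y
        using G_le[of y] g_abs_le[of y] unfolding \<beta>_def by linarith
      have i: "integrable M (\<lambda>\<omega>. (\<beta> (x - R \<omega>))\<^sup>2)"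
      proof (rule integrable_bounded[where C = "(F0 / \<bar>a k\<bar> * L1 + F0 / \<bar>a k\<bar>)\<^sup>2"])
        show "\<bar>(\<beta> (x - R \<omega>))\<^sup>2\<bar> \<le> (F0 / \<bar>a k\<bar> * L1 + F0 / \<bar>a k\<bar>)\<^sup>2" for \<omega>
          using power_mono[OF b[of "x - R \<omega>"], of 2] by simp
      qed measurable
      have "(smoothed_density \<kappa> x - f x)\<^sup>2 \<le> expectation (\<lambda>\<omega>. (\<beta> (x - R \<omega>))\<^sup>2) * expectation (\<lambda>\<omega>. 1\<^sup>2)"
        unfolding e by (rule integral_Cauchy_Schwarz) (use i in auto)
      then have "ennreal ((smoothed_density \<kappa> x - f x)\<^sup>2) \<le> ennreal (expectation (\<lambda>\<omega>. (\<beta> (x - R \<omega>))\<^sup>2))"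
        by (intro ennreal_leI) (simp add: prob_space)
      then show ?case using i by (simp add: nn_integral_eq_integral)
    qed
  qed
  also have "\<dots> = (\<integral>\<^sup>+\<omega>. \<integral>\<^sup>+x. ennreal ((\<beta> (x - R \<omega>))\<^sup>2) \<partial>lborel \<partial>M)"
    by (rule P.Fubini', measurable)
  also have "\<dots> = (\<integral>\<^sup>+\<omega>. \<integral>\<^sup>+y. ennreal ((\<beta> y)\<^sup>2) \<partial>lborel \<partial>M)"
  proof (rule nn_integral_cong)
    fix \<omega>
    show "(\<integral>\<^sup>+x. ennreal ((\<beta> (x - R \<omega>))\<^sup>2) \<partial>lborel) = (\<integral>\<^sup>+y. ennreal ((\<beta> y)\<^sup>2) \<partial>lborel)"
      using nn_integral_real_affine[of "\<lambda>y. ennreal ((\<beta> y)\<^sup>2)" 1 "- R \<omega>"] by simp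
  qed
  also have "\<dots> = (\<integral>\<^sup>+y. ennreal ((\<beta> y)\<^sup>2) \<partial>lborel)"
    by (simp add: emeasure_space_1)
  also have "\<dots> \<le> ennreal (4 * L1\<^sup>2 * \<rho> ^ 4 * (\<integral>x. (g2 x)\<^sup>2 \<partial>lborel))"
    unfolding \<beta>_def G_def
    by (rule smoothing_bias_L2[OF g_deriv1 g_deriv2 g2_L2 g_abs_le \<kappa>_int \<kappa> supp \<rho>])
  finally show ?thesis .
qed

end

section \<open>Rescaled kernels and rates\<close>

lemma bounded_kernel_rescale:
  fixes K :: "real \<Rightarrow> real"
  assumes K: "integrable lborel K" "\<And>u. isCont K u" "\<And>u. \<bar>K u\<bar> \<le> B" and h: "h > 0"
  shows "bounded_kernel (\<lambda>x. K (x / h) / h) (B / h)"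
proof
  show "integrable lborel (\<lambda>x. K (x / h) / h)"
    using lborel_integrable_real_affine[OF K(1), of "1 / h" 0] h by simp
  show "isCont (\<lambda>x. K (x / h) / h) x" for x
  proof -
    have "isCont (\<lambda>x. x / h) x" using h by (intro continuous_intros) auto
    from isCont_o2[OF this K(2)] show ?thesis using h by (intro continuous_intros) auto
  qed
  show "\<bar>K (x / h) / h\<bar> \<le> B / h" for x
    using K(3) h by (simp add: divide_right_mono)
qed

lemma integral_rescale:
  fixes u :: "real \<Rightarrow> real"
  assumes "h > 0"
  shows "(\<integral>x. u (x / h) / h \<partial>lborel) = (\<integral>x. u x \<partial>lborel)"
  using lborel_integral_real_affine[of h "\<lambda>x. u (x / h) / h" 0] assms by simp

lemma integral_abs_rescale:
  fixes u :: "real \<Rightarrow> real"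
  assumes "h > 0"
  shows "(\<integral>x. \<bar>u (x / h) / h\<bar> \<partial>lborel) = (\<integral>x. \<bar>u x\<bar> \<partial>lborel)"
  using integral_rescale[OF assms, of "\<lambda>x. \<bar>u x\<bar>"] assms by simp

lemma integral_moment_rescale:
  fixes u :: "real \<Rightarrow> real"
  assumes "h > 0"
  shows "(\<integral>x. x * (u (x / h) / h) \<partial>lborel) = h * (\<integral>x. x * u x \<partial>lborel)"
  using lborel_integral_real_affine[of h "\<lambda>x. x * (u (x / h) / h)" 0] assms by (simp add: mult.assoc)

lemma isCont_of_Hoelder:
  fixes K :: "real \<Rightarrow> real"
  assumes "0 < \<iota>" "\<And>u v. \<bar>K u - K v\<bar> \<le> C * \<bar>u - v\<bar> powr \<iota>"
  shows "isCont K x"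
proof -
  have "((\<lambda>u. C * \<bar>u - x\<bar> powr \<iota>) \<longlongrightarrow> C * 0 powr \<iota>) (at x)"
  proof (intro tendsto_mult tendsto_const tendsto_powr')
    show "((\<lambda>u. \<bar>u - x\<bar>) \<longlongrightarrow> 0) (at x)"
      by (rule tendsto_eq_intros refl | simp)+
  qed (use assms in auto)
  then have lim: "((\<lambda>u. C * \<bar>u - x\<bar> powr \<iota>) \<longlongrightarrow> 0) (at x)" by simp
  have "((\<lambda>u. K u - K x) \<longlongrightarrow> 0) (at x)"
    by (rule Lim_null_comparison[OF always_eventually lim]) (use assms in auto)
  then show ?thesis by (simp add: isCont_def LIM_zero_iff)
qed

lemma L2norm_le:
  assumes "(\<integral>\<^sup>+\<omega>. ennreal ((Y \<omega>)\<^sup>2) \<partial>M) \<le> ennreal z" "z \<ge> 0"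
  shows "L2norm M Y \<le> ennreal (sqrt z)"
proof -
  define I where "I = (\<integral>\<^sup>+\<omega>. ennreal ((Y \<omega>)\<^sup>2) \<partial>M)"
  have I: "I \<le> ennreal z" using assms by (simp add: I_def)
  then have "I < \<top>" by (rule le_less_trans) simp
  moreover have "enn2real I \<le> z" using I assms(2) by (rule enn2real_leI[rotated])
  ultimately show ?thesis
    by (auto simp: L2norm_def I_def[symmetric] Let_def intro!: ennreal_leI)
qed

section \<open>Mean integrated squared error and the resulting entropy error\<close>

context linear_process
begin

lemma f_measurable[measurable]: "f \<in> borel_measurable borel"
  using distributed_real_measurable[OF _ X_dens] f_nonneg by auto

lemma f_integral: "integrable lborel f" "(\<integral>x. f x \<partial>lborel) = 1"
proof -
  show "integrable lborel f"
    using distributed_integrable[OF X_dens, of "\<lambda>_. 1"] f_nonneg by simp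
  show "(\<integral>x. f x \<partial>lborel) = 1"
    using distributed_integral[OF X_dens, of "\<lambda>_. 1"] f_nonneg by (simp add: prob_space)
qed

text \<open>The error is split at the mean of the estimator by (u + v)^2 \<le> 2 u^2 + 2 v^2, whence
  the factors 2.\<close>

lemma expected_ISE_le:
  assumes \<kappa>: "bounded_kernel \<kappa> B" "(\<integral>u. \<kappa> u \<partial>lborel) = 1" "(\<integral>u. u * \<kappa> u \<partial>lborel) = 0"
    and supp: "\<And>u. \<bar>u\<bar> > \<rho> \<Longrightarrow> \<kappa> u = 0" and \<rho>: "\<rho> \<ge> 0" and n: "n > 0"
  defines "L \<equiv> \<integral>u. \<bar>\<kappa> u\<bar> \<partial>lborel"
  shows "(\<integral>\<^sup>+\<omega>. \<integral>\<^sup>+x. ennreal (((1 / real n) * (\<Sum>i=1..n. \<kappa> (x - X i \<omega>)) - f x)\<^sup>2) \<partial>lborel \<partial>M)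
    \<le> ennreal (2 * ((2 * B * L + 4 * (F2 / \<bar>a k\<bar> ^ 3 * L\<^sup>2) * \<sigma> * (\<Sum>l. \<bar>a l\<bar>)\<^sup>2) / real n)
              + 2 * (4 * L\<^sup>2 * \<rho> ^ 4 * (\<integral>x. (g2 x)\<^sup>2 \<partial>lborel)))"
proof -
  interpret bounded_kernel \<kappa> B by fact
  define q where "q = smoothed_density \<kappa>"
  define p where "p x \<omega> = (1 / real n) * (\<Sum>i=1..n. \<kappa> (x - X i \<omega>))" for x \<omega>
  have [measurable]: "q \<in> borel_measurable borel" unfolding q_def smoothed_density_def by measurable
  have [measurable]: "(\<lambda>z. p (snd z) (fst z)) \<in> borel_measurable (M \<Otimes>\<^sub>M borel)" unfolding p_def by measurable
  have sq: "ennreal ((p x \<omega> - f x)\<^sup>2) \<le> 2 * ennreal ((p x \<omega> - q x)\<^sup>2) + 2 * ennreal ((q x - f x)\<^sup>2)" for x \<omega>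
  proof -
    have "(p x \<omega> - f x)\<^sup>2 = (p x \<omega> - q x)\<^sup>2 + (q x - f x)\<^sup>2 + 2 * (p x \<omega> - q x) * (q x - f x)"
      by (simp add: power2_eq_square algebra_simps)
    then have "(p x \<omega> - f x)\<^sup>2 \<le> 2 * (p x \<omega> - q x)\<^sup>2 + 2 * (q x - f x)\<^sup>2"
      using sum_squares_bound[of "p x \<omega> - q x" "q x - f x"] by linarith
    then have "ennreal ((p x \<omega> - f x)\<^sup>2) \<le> ennreal (2 * (p x \<omega> - q x)\<^sup>2 + 2 * (q x - f x)\<^sup>2)"
      by (rule ennreal_leI)
    then show ?thesis by (simp add: ennreal_mult)
  qed
  have [measurable]: "(\<lambda>x. p x \<omega>) \<in> borel_measurable borel" for \<omega> unfolding p_def by measurable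
  have "(\<integral>\<^sup>+\<omega>. \<integral>\<^sup>+x. ennreal ((p x \<omega> - f x)\<^sup>2) \<partial>lborel \<partial>M)
      \<le> (\<integral>\<^sup>+\<omega>. \<integral>\<^sup>+x. 2 * ennreal ((p x \<omega> - q x)\<^sup>2) + 2 * ennreal ((q x - f x)\<^sup>2) \<partial>lborel \<partial>M)"
    by (intro nn_integral_mono sq)
  also have "\<dots> = (\<integral>\<^sup>+\<omega>. 2 * (\<integral>\<^sup>+x. ennreal ((p x \<omega> - q x)\<^sup>2) \<partial>lborel) + 2 * (\<integral>\<^sup>+x. ennreal ((q x - f x)\<^sup>2) \<partial>lborel) \<partial>M)"
    by (intro nn_integral_cong) (simp add: nn_integral_add nn_integral_cmult)
  also have "\<dots> = 2 * (\<integral>\<^sup>+\<omega>. \<integral>\<^sup>+x. ennreal ((p x \<omega> - q x)\<^sup>2) \<partial>lborel \<partial>M) + 2 * (\<integral>\<^sup>+x. ennreal ((q x - f x)\<^sup>2) \<partial>lborel)"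
  proof -
    have [measurable]: "(\<lambda>\<omega>. \<integral>\<^sup>+x. ennreal ((p x \<omega> - q x)\<^sup>2) \<partial>lborel) \<in> borel_measurable M"
      unfolding p_def by measurable
    show ?thesis by (simp add: nn_integral_add nn_integral_cmult emeasure_space_1)
  qed
  also have "\<dots> \<le> 2 * ennreal ((2 * B * L + 4 * (F2 / \<bar>a k\<bar> ^ 3 * L\<^sup>2) * \<sigma> * (\<Sum>l. \<bar>a l\<bar>)\<^sup>2) / real n)
      + 2 * ennreal (4 * L\<^sup>2 * \<rho> ^ 4 * (\<integral>x. (g2 x)\<^sup>2 \<partial>lborel))"
    unfolding p_def q_def L_def
    using integrated_variance_le[OF \<kappa>(1) n] integrated_bias_le[OF \<kappa> supp \<rho>]
    by (intro add_mono mult_left_mono) auto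
  also have "\<dots> = ennreal (2 * ((2 * B * L + 4 * (F2 / \<bar>a k\<bar> ^ 3 * L\<^sup>2) * \<sigma> * (\<Sum>l. \<bar>a l\<bar>)\<^sup>2) / real n)
              + 2 * (4 * L\<^sup>2 * \<rho> ^ 4 * (\<integral>x. (g2 x)\<^sup>2 \<partial>lborel)))"
  proof -
    have "0 \<le> (2 * B * L + 4 * (F2 / \<bar>a k\<bar> ^ 3 * L\<^sup>2) * \<sigma> * (\<Sum>l. \<bar>a l\<bar>)\<^sup>2) / real n"
      using B_nonneg F2_nonneg \<sigma>_nonneg by (simp add: L_def)
    moreover have "0 \<le> 4 * L\<^sup>2 * \<rho> ^ 4 * (\<integral>x. (g2 x)\<^sup>2 \<partial>lborel)"
      using \<rho> by simp
    moreover have "2 * ennreal y + 2 * ennreal z = ennreal (2 * y + 2 * z)" if "0 \<le> y" "0 \<le> z" for y z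
      using that by (simp add: ennreal_mult)
    ultimately show ?thesis by blast
  qed
  finally show ?thesis unfolding p_def .
qed

text \<open>A deterministic bound for every sample point. The kernel may change sign, so the
  estimator is controlled through its L1 norm and its supremum instead of as a density.\<close>

lemma truncated_entropy_error_le:
  assumes \<kappa>: "bounded_kernel \<kappa> B" and n: "n > 0" and \<gamma>: "0 < \<gamma>" "\<gamma> \<le> 1"
    and fl: "integrable lborel (\<lambda>x. f x * ln (f x))"
  defines "p \<equiv> \<lambda>\<omega> x. (1 / real n) * (\<Sum>i=1..n. \<kappa> (x - X i \<omega>))"
  shows "ennreal (((- (LINT x:{x. \<gamma> \<le> p \<omega> x}|lborel. p \<omega> x * ln (p \<omega> x)))
            - (LINT x:{x. \<gamma> \<le> p \<omega> x}|lborel. (- ln (f x)) * f x))\<^sup>2)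
    \<le> ennreal ((12 * (\<integral>u. \<bar>\<kappa> u\<bar> \<partial>lborel) + 4 * (F0 / \<bar>a k\<bar>)) / \<gamma>\<^sup>2) * (\<integral>\<^sup>+x. ennreal ((p \<omega> x - f x)\<^sup>2) \<partial>lborel)"
proof -
  interpret bounded_kernel \<kappa> B by fact
  have F: "F0 / \<bar>a k\<bar> \<ge> 0" using g_abs_le[of 0] by linarith
  have ki: "integrable lborel (\<lambda>x. \<kappa> (x - z))" "(\<integral>x. \<bar>\<kappa> (x - z)\<bar> \<partial>lborel) = L1" for z
    using lborel_integrable_real_affine[OF \<kappa>_int, of 1 "-z"]
      lborel_integral_real_affine[of 1 "\<lambda>x. \<bar>\<kappa> x\<bar>" "-z"] by simp_all
  have p_int: "integrable lborel (p \<omega>)" unfolding p_def using ki by simp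
  have p_abs: "\<bar>p \<omega> x\<bar> \<le> (1 / real n) * (\<Sum>i=1..n. \<bar>\<kappa> (x - X i \<omega>)\<bar>)" for x
    using sum_abs[of "\<lambda>i. \<kappa> (x - X i \<omega>)" "{1..n}"] n by (simp add: p_def abs_mult divide_right_mono)
  have p_L1: "(\<integral>x. \<bar>p \<omega> x\<bar> \<partial>lborel) \<le> L1"
  proof -
    have "(\<integral>x. \<bar>p \<omega> x\<bar> \<partial>lborel) \<le> (\<integral>x. (1 / real n) * (\<Sum>i=1..n. \<bar>\<kappa> (x - X i \<omega>)\<bar>) \<partial>lborel)"
    proof (rule integral_mono)
      show "integrable lborel (\<lambda>x. \<bar>p \<omega> x\<bar>)" using p_int by (rule integrable_abs)
      show "integrable lborel (\<lambda>x. (1 / real n) * (\<Sum>i=1..n. \<bar>\<kappa> (x - X i \<omega>)\<bar>))" using ki by simp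
    qed (rule p_abs)
    also have "\<dots> = L1" using ki n by simp
    finally show ?thesis .
  qed
  have p_le: "\<bar>p \<omega> x\<bar> \<le> B" for x
  proof -
    have "(1 / real n) * (\<Sum>i=1..n. \<bar>\<kappa> (x - X i \<omega>)\<bar>) \<le> (1 / real n) * (\<Sum>i=1..n. B)"
      by (intro mult_left_mono sum_mono \<kappa>_le) auto
    also have "\<dots> = B" using n by simp
    finally show ?thesis using p_abs[of x] by linarith
  qed
  have [measurable]: "p \<omega> \<in> borel_measurable borel" using p_int by auto
  \<comment> \<open>Both functions are integrable and essentially bounded, so the square is
    dominated by a multiple of the absolute difference.\<close>
  have D: "integrable lborel (\<lambda>x. (p \<omega> x - f x)\<^sup>2)"
  proof (rule Bochner_Integration.integrable_bound[of _ "\<lambda>x. (B + F0 / \<bar>a k\<bar>) * \<bar>p \<omega> x - f x\<bar>"])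
    show "integrable lborel (\<lambda>x. (B + F0 / \<bar>a k\<bar>) * \<bar>p \<omega> x - f x\<bar>)"
      using p_int f_integral(1) by auto
    show "AE x in lborel. norm ((p \<omega> x - f x)\<^sup>2) \<le> norm ((B + F0 / \<bar>a k\<bar>) * \<bar>p \<omega> x - f x\<bar>)"
      using AE_density_le
    proof eventually_elim
      case (elim x)
      have "\<bar>p \<omega> x - f x\<bar> \<le> B + F0 / \<bar>a k\<bar>"
        using elim f_nonneg[of x] p_le[of x] by linarith
      then have "\<bar>p \<omega> x - f x\<bar> * \<bar>p \<omega> x - f x\<bar> \<le> (B + F0 / \<bar>a k\<bar>) * \<bar>p \<omega> x - f x\<bar>"
        by (rule mult_right_mono) simp
      then show ?case using F B_nonneg by (simp add: power2_eq_square abs_mult)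
    qed
  qed measurable
  have L1: "L1 \<ge> 0" by simp
  have c: "(12 * L1 + 4 * (F0 / \<bar>a k\<bar>)) / \<gamma>\<^sup>2 \<ge> 0" using F L1 by simp
  have "((- (LINT x:{x. \<gamma> \<le> p \<omega> x}|lborel. p \<omega> x * ln (p \<omega> x)))
            - (LINT x:{x. \<gamma> \<le> p \<omega> x}|lborel. (- ln (f x)) * f x))\<^sup>2
      \<le> (12 * L1 + 4 * (F0 / \<bar>a k\<bar>)) / \<gamma>\<^sup>2 * (\<integral>x. (p \<omega> x - f x)\<^sup>2 \<partial>lborel)"
    by (rule truncated_entropy_diff_sq_le[OF f_integral(1) f_nonneg f_integral(2) AE_density_le F fl p_int p_L1 D \<gamma>])
  then have "ennreal (((- (LINT x:{x. \<gamma> \<le> p \<omega> x}|lborel. p \<omega> x * ln (p \<omega> x)))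
            - (LINT x:{x. \<gamma> \<le> p \<omega> x}|lborel. (- ln (f x)) * f x))\<^sup>2)
      \<le> ennreal ((12 * L1 + 4 * (F0 / \<bar>a k\<bar>)) / \<gamma>\<^sup>2 * (\<integral>x. (p \<omega> x - f x)\<^sup>2 \<partial>lborel))"
    by (rule ennreal_leI)
  also have "\<dots> = ennreal ((12 * L1 + 4 * (F0 / \<bar>a k\<bar>)) / \<gamma>\<^sup>2) * (\<integral>\<^sup>+x. ennreal ((p \<omega> x - f x)\<^sup>2) \<partial>lborel)"
    using D by (subst ennreal_mult[OF c]) (simp_all add: nn_integral_eq_integral)
  finally show ?thesis .
qed

end

text \<open>The lower half of the rate makes 1/(n h) of order h^4. The upper half compares the
  normalising factor, which is exactly \<gamma>^2 / r^2, with \<gamma>^2 / h^2. The quantifier over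
  \<gamma> is inside, so that a value depending on n can be inserted.\<close>

lemma bandwidth_rate:
  fixes h :: "nat \<Rightarrow> real"
  assumes h: "\<And>n. h n > 0" and rate: "h \<in> \<Theta>(\<lambda>n. (ln (real n) / real n) powr (1/5))"
  shows "\<exists>c1 c2. c1 > 0 \<and> c2 > 0 \<and> (\<forall>\<^sub>F n in sequentially. c1 \<le> real n * h n ^ 5 \<and>
    (\<forall>\<gamma>>0. ((real n * \<gamma> ^ 5) / ln (real n)) powr (2/5) \<le> c2 * \<gamma>\<^sup>2 / (h n)\<^sup>2))"
proof -
  define r where "r n = (ln (real n) / real n) powr (1/5)" for n
  obtain c where c: "c > 0" "\<forall>\<^sub>F n in sequentially. norm (h n) \<le> c * norm (r n)"
    using landau_o.bigE[OF bigthetaD1[OF rate]] unfolding r_def by blast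
  obtain d where d: "d > 0" "\<forall>\<^sub>F n in sequentially. norm (h n) \<ge> d * norm (r n)"
    using landau_omega.bigE[OF bigthetaD2[OF rate]] unfolding r_def by blast
  have "\<forall>\<^sub>F n in sequentially. d ^ 5 \<le> real n * h n ^ 5 \<and>
    (\<forall>\<gamma>>0. ((real n * \<gamma> ^ 5) / ln (real n)) powr (2/5) \<le> c\<^sup>2 * \<gamma>\<^sup>2 / (h n)\<^sup>2)"
    \<comment> \<open>n \<ge> 3 ensures ln n \<ge> 1, which allows the logarithm to be dropped from
      the lower bound on n h^5.\<close>
    using c(2) d(2) eventually_ge_at_top[of "3::nat"]
  proof eventually_elim
    case (elim n)
    define s where "s = ln (real n) / real n"
    have ln: "ln (real n) \<ge> 1"
      using elim(3) exp_le by (subst ln_ge_iff) (auto intro: order_trans[OF exp_le])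
    have s: "s > 0" unfolding s_def using ln elim(3) by (intro divide_pos_pos) auto
    have r: "r n = s powr (1/5)" "r n > 0" using s by (simp_all add: r_def s_def[symmetric])
    have r5: "r n ^ 5 = s" using s by (simp add: r powr_power)
    have r2: "(r n)\<^sup>2 = s powr (2/5)" using s by (simp add: r powr_power)
    have "(d * r n) ^ 5 \<le> h n ^ 5"
      using elim(2) h[of n] r d by (intro power_mono) auto
    then have "real n * (d ^ 5 * s) \<le> real n * h n ^ 5"
      by (intro mult_left_mono) (auto simp: power_mult_distrib r5)
    moreover have "real n * (d ^ 5 * s) = d ^ 5 * ln (real n)"
      using elim(3) by (simp add: s_def)
    moreover have "d ^ 5 * 1 \<le> d ^ 5 * ln (real n)"
      using d ln by (intro mult_left_mono) auto
    ultimately have 1: "d ^ 5 \<le> real n * h n ^ 5" by linarith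
    have "h n ^ 2 \<le> (c * r n)\<^sup>2"
      using elim(1) h[of n] r c by (intro power_mono) auto
    then have hr: "1 / (r n)\<^sup>2 \<le> c\<^sup>2 / (h n)\<^sup>2"
      using h[of n] r by (simp add: field_simps power_mult_distrib)
    have "((real n * \<gamma> ^ 5) / ln (real n)) powr (2/5) \<le> c\<^sup>2 * \<gamma>\<^sup>2 / (h n)\<^sup>2" if g: "\<gamma> > 0" for \<gamma>
    proof -
      have "(real n * \<gamma> ^ 5) / ln (real n) = \<gamma> ^ 5 / s" by (simp add: s_def)
      moreover have "(\<gamma> ^ 5 / s) powr (2/5) = (\<gamma> ^ 5) powr (2/5) / s powr (2/5)"
        using g s by (simp add: powr_divide)
      moreover have "(\<gamma> ^ 5) powr (2/5) = \<gamma>\<^sup>2"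
      proof -
        have "(\<gamma> ^ 5) powr (2/5) = (\<gamma> powr 5) powr (2/5)" using g by simp
        also have "\<dots> = \<gamma> powr 2" by (simp add: powr_powr)
        finally show ?thesis using g by simp
      qed
      ultimately have "((real n * \<gamma> ^ 5) / ln (real n)) powr (2/5) = \<gamma>\<^sup>2 * (1 / (r n)\<^sup>2)"
        by (simp add: r2)
      also have "\<dots> \<le> \<gamma>\<^sup>2 * (c\<^sup>2 / (h n)\<^sup>2)" using hr by (intro mult_left_mono) auto
      finally show ?thesis by (simp add: mult.commute)
    qed
    with 1 show ?case by blast
  qed
  then show ?thesis using c(1) d(1) by (intro exI[of _ "d ^ 5"] exI[of _ "c\<^sup>2"]) auto
qed


section \<open>Combination of the bounds at the given rate\<close>

theorem theorem2:
  fixes M :: "'a measure"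
    and eps :: "int \<Rightarrow> 'a \<Rightarrow> real"
    and fe fe1 fe2 :: "real \<Rightarrow> real"
    and a :: "nat \<Rightarrow> real"
    and f f1 f2 :: "real \<Rightarrow> real"
    and K :: "real \<Rightarrow> real"
    and h \<gamma> :: "nat \<Rightarrow> real"
  assumes prob: "prob_space M"
    and indep: "prob_space.indep_vars M (\<lambda>_. borel) eps UNIV"
    and eps_dens: "\<And>i. distributed M lborel (eps i) (\<lambda>x. ennreal (fe x))"
    and fe_nonneg: "\<And>x. fe x \<ge> 0"
    and eps_int: "\<And>i. integrable M (eps i)"
    and eps_mean: "\<And>i. prob_space.expectation M (eps i) = 0"
    and eps_var: "\<And>i. integrable M (\<lambda>\<omega>. (eps i \<omega>)\<^sup>2)"
    and a_abs: "summable (\<lambda>i. \<bar>a i\<bar>)"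
    and a_sum: "(\<Sum>i. a i) \<noteq> 0"
    and f_nonneg: "\<And>x. f x \<ge> 0"
    and X_dens: "\<And>n. distributed M lborel (linproc a eps n) (\<lambda>x. ennreal (f x))"
    and entropy_finite: "integrable lborel (\<lambda>x. f x * ln (f x))"
    and K_int: "integrable lborel K" "integral\<^sup>L lborel K = 1"
    and h_pos: "\<And>n. h n > 0"
    and h_rate: "h \<in> \<Theta>(\<lambda>n. (ln (real n) / real n) powr (1/5))"
    and K_bdd: "\<exists>B. \<forall>u. \<bar>K u\<bar> \<le> B"
    and K_supp: "bounded {u. K u \<noteq> 0}"
    and K_hoelder: "\<exists>\<iota> C. 0 < \<iota> \<and> \<iota> \<le> 1 \<and> (\<forall>u v. \<bar>K u - K v\<bar> \<le> C * \<bar>u - v\<bar> powr \<iota>)"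
    and K_moment: "(LINT u|lborel. u * K u) = 0"
    and fe_deriv1: "\<And>x. (fe has_real_derivative fe1 x) (at x)"
    and fe_deriv2: "\<And>x. (fe1 has_real_derivative fe2 x) (at x)"
    and fe_bdd: "\<exists>B. \<forall>x. \<bar>fe x\<bar> \<le> B"
    and fe1_bdd: "\<exists>B. \<forall>x. \<bar>fe1 x\<bar> \<le> B"
    and fe2_bdd: "\<exists>B. \<forall>x. \<bar>fe2 x\<bar> \<le> B"
    and fe_L2: "integrable lborel (\<lambda>x. (fe x)\<^sup>2)"
    and fe1_L2: "integrable lborel (\<lambda>x. (fe1 x)\<^sup>2)"
    and fe2_L2: "integrable lborel (\<lambda>x. (fe2 x)\<^sup>2)"
    and f_deriv1: "\<And>x. (f has_real_derivative f1 x) (at x)"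
    and f_deriv2: "\<And>x. (f1 has_real_derivative f2 x) (at x)"
    and f2_bdd: "\<exists>B. \<forall>x. \<bar>f2 x\<bar> \<le> B"
    and gamma_pos: "\<And>n. \<gamma> n > 0"
    and gamma_lim: "\<gamma> \<longlonglongrightarrow> 0"
    and h_gamma: "h \<in> o(\<gamma>)"
  shows "limsup (\<lambda>n. ennreal (((real n * (\<gamma> n) ^ 5) / ln (real n)) powr (2/5)) *
           L2norm M (\<lambda>\<omega>.
             let fn = kde K h (linproc a eps) n \<omega>;
                 A = {x. 0 < \<gamma> n \<and> \<gamma> n \<le> fn x}
             in (- (LINT x:A|lborel. fn x * ln (fn x)))
                - (LINT x:A|lborel. (- ln (f x)) * f x)))
         < \<infinity>"
proof -
  interpret prob_space M by (rule prob)
  define \<sigma> where "\<sigma> = expectation (\<lambda>\<omega>. (eps 0 \<omega>)\<^sup>2)"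
  \<comment> \<open>The common density forces a common second moment.\<close>
  have \<sigma>: "expectation (\<lambda>\<omega>. (eps i \<omega>)\<^sup>2) = \<sigma>" for i
  proof -
    have "expectation (\<lambda>\<omega>. (eps i \<omega>)\<^sup>2) = (\<integral>x. fe x * x\<^sup>2 \<partial>lborel)" for i
      by (rule distributed_integral[OF eps_dens, symmetric]) (use fe_nonneg in auto)
    then show ?thesis by (simp add: \<sigma>_def)
  qed
  obtain F0 where F0: "\<And>x. \<bar>fe x\<bar> \<le> F0" using fe_bdd by blast
  obtain F2 where F2: "\<And>x. \<bar>fe2 x\<bar> \<le> F2" using fe2_bdd by blast
  define k where "k = (LEAST k. a k \<noteq> 0)"
  have "\<exists>k. a k \<noteq> 0"
  proof (rule ccontr)
    assume "\<nexists>k. a k \<noteq> 0"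
    then have "a = (\<lambda>_. 0)" by auto
    with a_sum show False by simp
  qed
  then have k: "a k \<noteq> 0" unfolding k_def by (rule LeastI_ex)
  have k_least: "a l = 0" if "l < k" for l
    using not_less_Least[OF that[unfolded k_def]] by simp
  interpret linear_process M eps \<sigma> fe fe1 fe2 f a k F0 F2
  proof
    show "indep_vars (\<lambda>_. borel) eps UNIV" by (rule indep)
    show "fe x \<le> F0" for x using F0[of x] by linarith
  qed (use \<sigma> eps_var eps_dens fe_nonneg fe_deriv1 fe_deriv2 F2 fe2_L2 a_abs k k_least f_nonneg X_dens in auto)
  obtain BK where BK: "\<And>u. \<bar>K u\<bar> \<le> BK" using K_bdd by blast
  have BK0: "BK \<ge> 0" using BK[of 0] by linarith
  obtain r where r: "r > 0" "\<And>u. K u \<noteq> 0 \<Longrightarrow> \<bar>u\<bar> \<le> r"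
    using K_supp unfolding bounded_pos by auto
  obtain \<iota> C where "0 < \<iota>" "\<And>u v. \<bar>K u - K v\<bar> \<le> C * \<bar>u - v\<bar> powr \<iota>"
    using K_hoelder by blast
  then have K_cont: "isCont K u" for u by (rule isCont_of_Hoelder)
  define L where "L = (\<integral>u. \<bar>K u\<bar> \<partial>lborel)"
  have L0: "L \<ge> 0" by (simp add: L_def)
  define G where "G = (\<integral>x. (g2 x)\<^sup>2 \<partial>lborel)"
  have G0: "G \<ge> 0" by (simp add: G_def)
  obtain c1 c2 where c: "c1 > 0" "c2 > 0"
    and rate: "\<forall>\<^sub>F n in sequentially. c1 \<le> real n * h n ^ 5 \<and>
      (\<forall>\<gamma>>0. ((real n * \<gamma> ^ 5) / ln (real n)) powr (2/5) \<le> c2 * \<gamma>\<^sup>2 / (h n)\<^sup>2)"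
    using bandwidth_rate[OF h_pos h_rate] by blast
  define C1 where "C1 = 4 * (F2 / \<bar>a k\<bar> ^ 3 * L\<^sup>2) * \<sigma> * (\<Sum>l. \<bar>a l\<bar>)\<^sup>2"
  have C1: "C1 \<ge> 0" using F2_nonneg \<sigma>_nonneg by (simp add: C1_def)
  \<comment> \<open>The coefficient of h^4: the variance contributes through 1/(n h) \<le> h^4 / c1,
    the bias through a support of radius r h.\<close>
  define C2 where "C2 = 2 * ((2 * BK * L + C1) / c1) + 2 * (4 * L\<^sup>2 * r ^ 4 * G)"
  have C2: "C2 \<ge> 0" using BK0 L0 C1 c r G0 by (simp add: C2_def)
  define C3 where "C3 = 12 * L + 4 * (F0 / \<bar>a k\<bar>)"
  have C3: "C3 \<ge> 0" using L0 g_abs_le[of 0] unfolding C3_def by (smt (verit))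
  have \<gamma>1: "\<forall>\<^sub>F n in sequentially. \<gamma> n \<le> 1"
    using order_tendstoD(2)[OF gamma_lim, of 1] by (auto elim: eventually_mono)
  have h\<gamma>: "\<forall>\<^sub>F n in sequentially. h n \<le> \<gamma> n"
    using landau_o.smallD[OF h_gamma, of 1] by (rule eventually_mono) (use h_pos gamma_pos in \<open>auto simp: abs_of_pos\<close>)
  have "\<forall>\<^sub>F n in sequentially. ennreal (((real n * (\<gamma> n) ^ 5) / ln (real n)) powr (2/5)) *
           L2norm M (\<lambda>\<omega>.
             let fn = kde K h (linproc a eps) n \<omega>;
                 A = {x. 0 < \<gamma> n \<and> \<gamma> n \<le> fn x}
             in (- (LINT x:A|lborel. fn x * ln (fn x)))
                - (LINT x:A|lborel. (- ln (f x)) * f x))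
         \<le> ennreal (c2 * sqrt (C3 * C2))"
    using rate \<gamma>1 h\<gamma> eventually_gt_at_top[of "0::nat"]
  proof eventually_elim
    case (elim n)
    have hn: "h n > 0" "h n \<le> 1" and gn: "\<gamma> n > 0" "\<gamma> n \<le> 1"
      using h_pos[of n] gamma_pos[of n] elim by auto
    define \<kappa> where "\<kappa> = (\<lambda>x. K (x / h n) / h n)"
    have \<kappa>: "bounded_kernel \<kappa> (BK / h n)"
      unfolding \<kappa>_def by (rule bounded_kernel_rescale[OF K_int(1) K_cont BK hn(1)])
    have \<kappa>1: "(\<integral>u. \<kappa> u \<partial>lborel) = 1" and \<kappa>L: "(\<integral>u. \<bar>\<kappa> u\<bar> \<partial>lborel) = L"
      and \<kappa>m: "(\<integral>u. u * \<kappa> u \<partial>lborel) = 0"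
      unfolding \<kappa>_def L_def using hn K_int K_moment
      by (simp_all only: integral_rescale integral_abs_rescale integral_moment_rescale)
    have supp: "\<kappa> u = 0" if "\<bar>u\<bar> > r * h n" for u
      using r(2)[of "u / h n"] that hn by (auto simp: \<kappa>_def field_simps)
    define p where "p \<omega> x = (1 / real n) * (\<Sum>i=1..n. \<kappa> (x - X i \<omega>))" for \<omega> x
    have p: "kde K h X n \<omega> = p \<omega>" for \<omega>
      by (rule ext) (simp add: kde_def p_def \<kappa>_def sum_divide_distrib[symmetric])
    define D where "D \<omega> = (- (LINT x:{x. \<gamma> n \<le> p \<omega> x}|lborel. p \<omega> x * ln (p \<omega> x)))
            - (LINT x:{x. \<gamma> n \<le> p \<omega> x}|lborel. (- ln (f x)) * f x)" for \<omega>
    have ISE: "(\<integral>\<^sup>+\<omega>. \<integral>\<^sup>+x. ennreal ((p \<omega> x - f x)\<^sup>2) \<partial>lborel \<partial>M) \<le> ennreal (C2 * h n ^ 4)"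
    proof -
      have "(\<integral>\<^sup>+\<omega>. \<integral>\<^sup>+x. ennreal ((p \<omega> x - f x)\<^sup>2) \<partial>lborel \<partial>M)
          \<le> ennreal (2 * ((2 * (BK / h n) * L + C1) / real n) + 2 * (4 * L\<^sup>2 * (r * h n) ^ 4 * G))"
        using expected_ISE_le[OF \<kappa> \<kappa>1 \<kappa>m supp _ elim(4)] r hn
        by (simp add: p_def \<kappa>L C1_def G_def)
      also have "\<dots> \<le> ennreal (C2 * h n ^ 4)"
      proof (rule ennreal_leI)
        \<comment> \<open>The off-diagonal part is only of order 1/n; since h \<le> 1 it is absorbed
          into the diagonal order 1/(n h).\<close>
        have "C1 \<le> C1 / h n" using C1 hn by (simp add: pos_le_divide_eq mult_left_le)
        then have "(2 * (BK / h n) * L + C1) / real n \<le> (2 * (BK / h n) * L + C1 / h n) / real n"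
          using elim(4) by (intro divide_right_mono) auto
        also have "\<dots> = (2 * BK * L + C1) * (1 / (h n * real n))"
          using hn elim(4) by (simp add: field_simps)
        also have "1 / (h n * real n) \<le> h n ^ 4 / c1"
        proof -
          have "c1 \<le> h n ^ 4 * (h n * real n)"
            using elim(1) by (simp add: numeral_eq_Suc ac_simps)
          then show ?thesis using c hn elim(4) by (simp add: field_simps)
        qed
        finally have "(2 * (BK / h n) * L + C1) / real n \<le> (2 * BK * L + C1) / c1 * h n ^ 4"
          using BK0 L0 C1 by (simp add: mult_left_mono)
        moreover have "C2 * h n ^ 4 = 2 * ((2 * BK * L + C1) / c1 * h n ^ 4) + 2 * (4 * L\<^sup>2 * (r * h n) ^ 4 * G)"
          unfolding C2_def power_mult_distrib distrib_right by (simp only: ac_simps)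
        ultimately show "2 * ((2 * (BK / h n) * L + C1) / real n) + 2 * (4 * L\<^sup>2 * (r * h n) ^ 4 * G) \<le> C2 * h n ^ 4"
          by linarith
      qed
      finally show ?thesis .
    qed
    \<comment> \<open>The comparison is pointwise in \<omega>, so monotonicity of the nonnegative
      integral applies directly to \<open>D\<close>; measurability is checked below only for the
      ISE.\<close>
    have "(\<integral>\<^sup>+\<omega>. ennreal ((D \<omega>)\<^sup>2) \<partial>M) \<le> (\<integral>\<^sup>+\<omega>. ennreal (C3 / (\<gamma> n)\<^sup>2) * (\<integral>\<^sup>+x. ennreal ((p \<omega> x - f x)\<^sup>2) \<partial>lborel) \<partial>M)"
      using truncated_entropy_error_le[OF \<kappa> elim(4) gn entropy_finite]
      unfolding D_def p_def \<kappa>L C3_def by (intro nn_integral_mono)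
    also have "\<dots> = ennreal (C3 / (\<gamma> n)\<^sup>2) * (\<integral>\<^sup>+\<omega>. \<integral>\<^sup>+x. ennreal ((p \<omega> x - f x)\<^sup>2) \<partial>lborel \<partial>M)"
    proof (rule nn_integral_cmult)
      have [measurable]: "\<kappa> \<in> borel_measurable borel" using \<kappa> by (rule bounded_kernel.\<kappa>_measurable)
      show "(\<lambda>\<omega>. \<integral>\<^sup>+x. ennreal ((p \<omega> x - f x)\<^sup>2) \<partial>lborel) \<in> borel_measurable M"
        unfolding p_def by measurable
    qed
    also have "\<dots> \<le> ennreal (C3 / (\<gamma> n)\<^sup>2) * ennreal (C2 * h n ^ 4)"
      by (rule mult_left_mono[OF ISE]) simp
    also have "\<dots> = ennreal (C3 * C2 * ((h n)\<^sup>2 / \<gamma> n)\<^sup>2)"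
      using C3 C2 by (subst ennreal_mult[symmetric]) (auto simp: power_divide)
    finally have "L2norm M D \<le> ennreal (sqrt (C3 * C2 * ((h n)\<^sup>2 / \<gamma> n)\<^sup>2))"
      using C3 C2 by (intro L2norm_le) auto
    also have "sqrt (C3 * C2 * ((h n)\<^sup>2 / \<gamma> n)\<^sup>2) = sqrt (C3 * C2) * ((h n)\<^sup>2 / \<gamma> n)"
      using gn by (simp add: real_sqrt_mult)
    \<comment> \<open>The factor \<gamma>^2 / h^2 meets the error h^2 / \<gamma>; what remains is
      \<gamma>, which is at most 1.\<close>
    finally have "ennreal (((real n * (\<gamma> n) ^ 5) / ln (real n)) powr (2/5)) * L2norm M D
        \<le> ennreal (c2 * (\<gamma> n)\<^sup>2 / (h n)\<^sup>2) * ennreal (sqrt (C3 * C2) * ((h n)\<^sup>2 / \<gamma> n))"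
      using elim(1) gn by (intro mult_mono ennreal_leI) auto
    also have "\<dots> = ennreal (c2 * sqrt (C3 * C2) * \<gamma> n)"
      using c C3 C2 gn hn
      by (subst ennreal_mult[symmetric]) (auto simp: field_simps power2_eq_square)
    also have "\<dots> \<le> ennreal (c2 * sqrt (C3 * C2))"
      using c C3 C2 gn by (intro ennreal_leI) (simp add: mult_left_le)
    finally show ?case
      unfolding p Let_def D_def using gn by simp
  qed
  then have "limsup (\<lambda>n. ennreal (((real n * (\<gamma> n) ^ 5) / ln (real n)) powr (2/5)) *
           L2norm M (\<lambda>\<omega>.
             let fn = kde K h (linproc a eps) n \<omega>;
                 A = {x. 0 < \<gamma> n \<and> \<gamma> n \<le> fn x}
             in (- (LINT x:A|lborel. fn x * ln (fn x)))
                - (LINT x:A|lborel. (- ln (f x)) * f x))) \<le> ennreal (c2 * sqrt (C3 * C2))"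
    by (rule Limsup_bounded)
  also have "\<dots> < \<infinity>" by simp
  finally show ?thesis .
qed

end
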